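(* Let $\mathcal{C}$ be a non-zero $A$-coring with ${}_A\mathcal{C}$ flat. (1) If $\mathcal{C}=\mathcal{C}f\mathcal{C}^{\ast}$ for all $0\neq f\in\mathcal{C}^{\ast}$, then the ring $\mathcal{C}^{\ast}$ is prime; if $\mathcal{C}=\mathcal{C}f$ for all $0\neq f\in\mathcal{C}^{\ast}$, then $\mathcal{C}^{\ast}$ is a domain. If $\mathcal{C}$ is coretractable in $\mathbb{M}^{\mathcal{C}}$, then $\mathcal{C}^{\ast}$ is prime if and only if $\mathcal{C}=\mathcal{C}f\mathcal{C}^{\ast}$ for all $0\neq f\in\mathcal{C}^{\ast}$, and $\mathcal{C}^{\ast}$ is a domain if and only if $\mathcal{C}=\mathcal{C}f$ for all $0\neq f\in\mathcal{C}^{\ast}$. (2) If $\mathcal{C}f=\mathcal{C}f\mathcal{C}^{\ast}f$ for all $0\neq f\in\mathcal{C}^{\ast}$, then $\mathcal{C}^{\ast}$ is semiprime; if $\mathcal{C}f=\mathcal{C}f^{2}$ for all $0\neq f\in\mathcal{C}^{\ast}$, then $\mathcal{C}^{\ast}$ is reduced. If $\mathcal{C}$ is self-cogenerator in $\mathbb{M}^{\mathcal{C}}$, then $\mathcal{C}^{\ast}$ is semiprime if and only if $\mathcal{C}f=\mathcal{C}f\mathcal{C}^{\ast}f$ for all $0\neq f\in\mathcal{C}^{\ast}$, and $\mathcal{C}^{\ast}$ is reduced if and only if $\mathcal{C}f=\mathcal{C}f^{2}$ for all $0\neq f\in\mathcal{C}^{\ast}$.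
   Context: $R$ is a commutative ring with $1\neq 0$, $A$ is a unital $R$-algebra, $(\mathcal{C},\Delta,\varepsilon)$ is an $A$-coring (a coalgebra in the monoidal category of $(A,A)$-bimodules), and $\mathbb{M}^{\mathcal{C}}$ is the category of right $\mathcal{C}$-comodules. Since ${}_A\mathcal{C}$ is flat, $\mathbb{M}^{\mathcal{C}}$ is a Grothendieck category with kernels formed in right $A$-modules; $\mathcal{C}$ is a right $\mathcal{C}$-comodule via $\Delta$. $\mathcal{C}^{\ast}=\mathrm{Hom}_{-A}(\mathcal{C},A)$ (right $A$-linear maps) is a ring with product $(f\ast^r g)(c)=\sum g(f(c_1)c_2)$ and unit $\varepsilon$. $\mathcal{C}$ is a right $\mathcal{C}^{\ast}$-module via $cf=c\leftharpoonup f:=\sum f(c_1)c_2$; for a subset $S\subseteq\mathcal{C}^{\ast}$, $\mathcal{C}S$ denotes the additive subgroup generated by all $cs$ with $c\in\mathcal{C}$, $s\in S$; so $\mathcal{C}f\mathcal{C}^{\ast}$, $\mathcal{C}f\mathcal{C}^{\ast}f$ and $\mathcal{C}f^2$ are formed with the product of $\mathcal{C}^{\ast}$. A domain need not be commutative. A right comodule $M$ is coretractable if $\mathrm{Hom}^{\mathcal{C}}(M/K,M)\neq 0$ for every proper subcomodule $K\subsetneq M$, and self-cogenerator if it cogenerates all its factor comodules, i.e. for every subcomodule $K\subseteq M$ the intersection of the kernels of all $h\in\mathrm{Hom}^{\mathcal{C}}(M/K,M)$ is $0$. *)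

theory Defs
  imports "HOL-Algebra.Free_Abelian_Groups" "HOL-Algebra.Ideal_Product" "HOL-Algebra.Module"
begin

section \<open>Noncommutative rings and algebras\<close>

text \<open>The library locale \<open>algebra\<close> requires a commutative algebra, and \<open>domain\<close> a commutative
  domain.\<close>

locale unital_algebra = R?: module R A + A?: ring A for R (structure) and A (structure) +
  assumes smult_mult_left: "\<lbrakk>r \<in> carrier R; a \<in> carrier A; b \<in> carrier A\<rbrakk> \<Longrightarrow>
      (r \<odot>\<^bsub>A\<^esub> a) \<otimes>\<^bsub>A\<^esub> b = r \<odot>\<^bsub>A\<^esub> (a \<otimes>\<^bsub>A\<^esub> b)"
    and smult_mult_right: "\<lbrakk>r \<in> carrier R; a \<in> carrier A; b \<in> carrier A\<rbrakk> \<Longrightarrow>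
      a \<otimes>\<^bsub>A\<^esub> (r \<odot>\<^bsub>A\<^esub> b) = r \<odot>\<^bsub>A\<^esub> (a \<otimes>\<^bsub>A\<^esub> b)"

locale prime_ring = ring +
  assumes one_not_zero: "\<one> \<noteq> \<zero>"
    and prime: "\<lbrakk>ideal I R; ideal J R; ideal_prod R I J = {\<zero>}\<rbrakk> \<Longrightarrow> I = {\<zero>} \<or> J = {\<zero>}"

locale semiprime_ring = ring +
  assumes semiprime: "\<lbrakk>ideal I R; ideal_prod R I I = {\<zero>}\<rbrakk> \<Longrightarrow> I = {\<zero>}"

locale nc_domain = ring +
  assumes one_not_zero: "\<one> \<noteq> \<zero>"
    and integral: "\<lbrakk>a \<in> carrier R; b \<in> carrier R; a \<otimes> b = \<zero>\<rbrakk> \<Longrightarrow> a = \<zero> \<or> b = \<zero>"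

locale reduced_ring = ring +
  assumes reduced: "\<lbrakk>a \<in> carrier R; a [^] (n::nat) = \<zero>\<rbrakk> \<Longrightarrow> a = \<zero>"


section \<open>Modules and bimodules over a noncommutative ring\<close>

text \<open>One record serves left modules, right modules and bimodules.  The fields that a given notion
  does not mention (the ring multiplication, and for a one-sided module the other action) are
  ignored, as \<open>mult\<close> and \<open>one\<close> are in the library's \<open>module\<close>.\<close>

record ('a, 'm) bimod = "'m ring" +
  lact :: "'a \<Rightarrow> 'm \<Rightarrow> 'm"
  ract :: "'m \<Rightarrow> 'a \<Rightarrow> 'm"

locale left_module = A?: ring A + M?: abelian_group M
  for A :: "('a, 'j) ring_scheme" (structure)
    and M :: "('a, 'm, 'k) bimod_scheme" (structure) +
  assumes lact_closed: "\<lbrakk>a \<in> carrier A; x \<in> carrier M\<rbrakk> \<Longrightarrow> lact M a x \<in> carrier M"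
    and lact_add_scalar: "\<lbrakk>a \<in> carrier A; b \<in> carrier A; x \<in> carrier M\<rbrakk> \<Longrightarrow>
      lact M (a \<oplus>\<^bsub>A\<^esub> b) x = lact M a x \<oplus>\<^bsub>M\<^esub> lact M b x"
    and lact_add: "\<lbrakk>a \<in> carrier A; x \<in> carrier M; y \<in> carrier M\<rbrakk> \<Longrightarrow>
      lact M a (x \<oplus>\<^bsub>M\<^esub> y) = lact M a x \<oplus>\<^bsub>M\<^esub> lact M a y"
    and lact_mult: "\<lbrakk>a \<in> carrier A; b \<in> carrier A; x \<in> carrier M\<rbrakk> \<Longrightarrow>
      lact M (a \<otimes>\<^bsub>A\<^esub> b) x = lact M a (lact M b x)"
    and lact_one: "x \<in> carrier M \<Longrightarrow> lact M \<one>\<^bsub>A\<^esub> x = x"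

locale right_module = A?: ring A + M?: abelian_group M
  for A :: "('a, 'j) ring_scheme" (structure)
    and M :: "('a, 'm, 'k) bimod_scheme" (structure) +
  assumes ract_closed: "\<lbrakk>a \<in> carrier A; x \<in> carrier M\<rbrakk> \<Longrightarrow> ract M x a \<in> carrier M"
    and ract_add_scalar: "\<lbrakk>a \<in> carrier A; b \<in> carrier A; x \<in> carrier M\<rbrakk> \<Longrightarrow>
      ract M x (a \<oplus>\<^bsub>A\<^esub> b) = ract M x a \<oplus>\<^bsub>M\<^esub> ract M x b"
    and ract_add: "\<lbrakk>a \<in> carrier A; x \<in> carrier M; y \<in> carrier M\<rbrakk> \<Longrightarrow>
      ract M (x \<oplus>\<^bsub>M\<^esub> y) a = ract M x a \<oplus>\<^bsub>M\<^esub> ract M y a"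
    and ract_mult: "\<lbrakk>a \<in> carrier A; b \<in> carrier A; x \<in> carrier M\<rbrakk> \<Longrightarrow>
      ract M x (a \<otimes>\<^bsub>A\<^esub> b) = ract M (ract M x a) b"
    and ract_one: "x \<in> carrier M \<Longrightarrow> ract M x \<one>\<^bsub>A\<^esub> = x"

locale bimodule = left_module A M + right_module A M
  for A :: "('a, 'j) ring_scheme" (structure)
    and M :: "('a, 'm, 'k) bimod_scheme" (structure) +
  assumes lact_ract: "\<lbrakk>a \<in> carrier A; b \<in> carrier A; x \<in> carrier M\<rbrakk> \<Longrightarrow>
      ract M (lact M a x) b = lact M a (ract M x b)"

definition regular_bimod :: "('a, 'k) ring_scheme \<Rightarrow> ('a, 'a) bimod" where
  "regular_bimod A = \<lparr>carrier = carrier A, monoid.mult = monoid.mult A, one = one A, zero = zero A,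
     add = add A, lact = monoid.mult A, ract = monoid.mult A\<rparr>"

definition additive_map ::
    "('m, 'k) ring_scheme \<Rightarrow> ('n, 'l) ring_scheme \<Rightarrow> ('m \<Rightarrow> 'n) \<Rightarrow> bool" where
  "additive_map M N h \<longleftrightarrow> h \<in> carrier M \<rightarrow> carrier N \<and>
     (\<forall>x\<in>carrier M. \<forall>y\<in>carrier M. h (x \<oplus>\<^bsub>M\<^esub> y) = h x \<oplus>\<^bsub>N\<^esub> h y)"

definition left_linear ::
    "('a, 'k) ring_scheme \<Rightarrow> ('a, 'm, 'l) bimod_scheme \<Rightarrow> ('a, 'n, 'j) bimod_scheme \<Rightarrow> ('m \<Rightarrow> 'n) \<Rightarrow> bool"
  where "left_linear A M N h \<longleftrightarrow> additive_map M N h \<and>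
     (\<forall>a\<in>carrier A. \<forall>x\<in>carrier M. h (lact M a x) = lact N a (h x))"

definition right_linear ::
    "('a, 'k) ring_scheme \<Rightarrow> ('a, 'm, 'l) bimod_scheme \<Rightarrow> ('a, 'n, 'j) bimod_scheme \<Rightarrow> ('m \<Rightarrow> 'n) \<Rightarrow> bool"
  where "right_linear A M N h \<longleftrightarrow> additive_map M N h \<and>
     (\<forall>a\<in>carrier A. \<forall>x\<in>carrier M. h (ract M x a) = ract N (h x) a)"

text \<open>Elements of Hom sets are extensional (\<open>undefined\<close> off the carrier), so that equality of
  morphisms is equality in HOL.\<close>

definition right_Hom ::
    "('a, 'k) ring_scheme \<Rightarrow> ('a, 'm, 'l) bimod_scheme \<Rightarrow> ('a, 'n, 'j) bimod_scheme \<Rightarrow> ('m \<Rightarrow> 'n) set"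
  where "right_Hom A M N = {h \<in> extensional (carrier M). right_linear A M N h}"


section \<open>Tensor products over a noncommutative ring\<close>

text \<open>The tensor product of a right module and a left module: the free abelian group on the pairs,
  modulo the subgroup generated by the bilinearity and balancing relations.\<close>

type_synonym ('m, 'n) tens = "('m \<times> 'n \<Rightarrow>\<^sub>0 int) set"

definition tensor_rel ::
    "('a, 'k) ring_scheme \<Rightarrow> ('a, 'm, 'l) bimod_scheme \<Rightarrow> ('a, 'n, 'j) bimod_scheme \<Rightarrow> ('m, 'n) tens"
  where "tensor_rel A M N = generate (free_Abelian_group (carrier M \<times> carrier N))
     ({frag_of (x \<oplus>\<^bsub>M\<^esub> x', y) - frag_of (x, y) - frag_of (x', y) | x x' y.
         x \<in> carrier M \<and> x' \<in> carrier M \<and> y \<in> carrier N} \<union>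
      {frag_of (x, y \<oplus>\<^bsub>N\<^esub> y') - frag_of (x, y) - frag_of (x, y') | x y y'.
         x \<in> carrier M \<and> y \<in> carrier N \<and> y' \<in> carrier N} \<union>
      {frag_of (ract M x a, y) - frag_of (x, lact N a y) | x a y.
         x \<in> carrier M \<and> a \<in> carrier A \<and> y \<in> carrier N})"

definition tensor_group ::
    "('a, 'k) ring_scheme \<Rightarrow> ('a, 'm, 'l) bimod_scheme \<Rightarrow> ('a, 'n, 'j) bimod_scheme \<Rightarrow>
     ('m, 'n) tens ring"
  where "tensor_group A M N =
     (let Q = free_Abelian_group (carrier M \<times> carrier N) Mod tensor_rel A M N
      in \<lparr>carrier = carrier Q, monoid.mult = undefined, one = undefined,
          zero = one Q, add = monoid.mult Q\<rparr>)"

definition pure_tensor ::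
    "('a, 'k) ring_scheme \<Rightarrow> ('a, 'm, 'l) bimod_scheme \<Rightarrow> ('a, 'n, 'j) bimod_scheme \<Rightarrow>
     'm \<Rightarrow> 'n \<Rightarrow> ('m, 'n) tens"
  where "pure_tensor A M N x y =
     tensor_rel A M N #>\<^bsub>free_Abelian_group (carrier M \<times> carrier N)\<^esub> frag_of (x, y)"

text \<open>\<open>tensor_lift P b\<close> is the additive map into \<open>P\<close> with value \<open>b x y\<close> on the pure tensor of \<open>x\<close>
  and \<open>y\<close>.  It is meaningful only when \<open>b\<close> is biadditive and balanced: then the
  \<open>\<int>\<close>-linear extension of \<open>b\<close> is constant on each coset \<open>t\<close>.\<close>

definition tensor_lift :: "('p, 'k) ring_scheme \<Rightarrow> ('m \<Rightarrow> 'n \<Rightarrow> 'p) \<Rightarrow> ('m, 'n) tens \<Rightarrow> 'p" where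
  "tensor_lift P b t = the_elem
     ((\<lambda>u. \<Oplus>\<^bsub>P\<^esub>p\<in>Poly_Mapping.keys u. add_pow P (Poly_Mapping.lookup u p) (b (fst p) (snd p))) ` t)"

text \<open>\<open>M\<close> and \<open>N\<close> are the factors of the target; the source is determined by the coset.\<close>

definition tensor_map ::
    "('a, 'k) ring_scheme \<Rightarrow> ('a, 'm, 'l) bimod_scheme \<Rightarrow> ('a, 'n, 'j) bimod_scheme \<Rightarrow>
     ('m0 \<Rightarrow> 'm) \<Rightarrow> ('n0 \<Rightarrow> 'n) \<Rightarrow> ('m0, 'n0) tens \<Rightarrow> ('m, 'n) tens"
  where "tensor_map A M N f g =
     tensor_lift (tensor_group A M N) (\<lambda>x y. pure_tensor A M N (f x) (g y))"

text \<open>The left action comes from the left factor, the right action from the right factor.\<close>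

definition tensor ::
    "('a, 'k) ring_scheme \<Rightarrow> ('a, 'm, 'l) bimod_scheme \<Rightarrow> ('a, 'n, 'j) bimod_scheme \<Rightarrow>
     ('a, ('m, 'n) tens) bimod"
  where "tensor A M N = ring.extend (tensor_group A M N)
     (bimod.fields (\<lambda>a. tensor_map A M N (lact M a) id)
                   (\<lambda>t a. tensor_map A M N id (\<lambda>y. ract N y a) t))"

text \<open>The associativity constraint, sending \<open>(x \<otimes> y) \<otimes> z\<close> to \<open>x \<otimes> (y \<otimes> z)\<close>.\<close>

definition tensor_assoc ::
    "('a, 'k) ring_scheme \<Rightarrow> ('a, 'm, 'l) bimod_scheme \<Rightarrow> ('a, 'n, 'j) bimod_scheme \<Rightarrow>
     ('a, 'p, 'i) bimod_scheme \<Rightarrow> (('m, 'n) tens, 'p) tens \<Rightarrow> ('m, ('n, 'p) tens) tens"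
  where "tensor_assoc A M N P =
     (let T = tensor A M (tensor A N P)
      in tensor_lift T (\<lambda>t z. tensor_lift T
           (\<lambda>x y. pure_tensor A M (tensor A N P) x (pure_tensor A N P y z)) t))"

text \<open>Flatness of a left module \<open>N\<close>: tensoring with \<open>N\<close> preserves injectivity of right-linear maps.
  HOL cannot quantify over modules of all types inside a formula, so the test modules live in the
  fixed type \<open>('a + 'n, 'n) tens\<close>.  This is no restriction.  The type is infinite and has at least
  the cardinality of \<open>'a\<close>, so it carries a copy of every finitely generated right module; and
  an element in the kernel of \<open>M' \<otimes> N \<rightarrow> M \<otimes> N\<close> is already in the kernel of \<open>M0' \<otimes> N \<rightarrow> M0 \<otimes> N\<close> for
  some finitely generated submodules \<open>M0' \<subseteq> M'\<close>, \<open>M0 \<subseteq> M\<close>.  (It also carries copies of \<open>N\<close> and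
  of the tensor product of a bimodule \<open>N\<close> with itself.)\<close>

definition flat_left_module ::
    "('a, 'k) ring_scheme \<Rightarrow> ('a, 'n, 'j) bimod_scheme \<Rightarrow> bool" where
  "flat_left_module A N \<longleftrightarrow> left_module A N \<and>
     (\<forall>(M' :: ('a, ('a + 'n, 'n) tens) bimod) (M :: ('a, ('a + 'n, 'n) tens) bimod) h.
        right_module A M' \<and> right_module A M \<and> right_linear A M' M h \<and> inj_on h (carrier M') \<longrightarrow>
        inj_on (tensor_map A M N h id) (carrier (tensor A M' N)))"


section \<open>Corings and right comodules\<close>

record ('a, 'c) coring = "('a, 'c) bimod" +
  comult :: "'c \<Rightarrow> ('c, 'c) tens"
  counit :: "'c \<Rightarrow> 'a"

locale coring = C?: bimodule A C
  for A :: "('a, 'j) ring_scheme" (structure)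
    and C :: "('a, 'c, 'k) coring_scheme" (structure) +
  assumes comult_left_linear: "left_linear A C (tensor A C C) (comult C)"
    and comult_right_linear: "right_linear A C (tensor A C C) (comult C)"
    and counit_left_linear: "left_linear A C (regular_bimod A) (counit C)"
    and counit_right_linear: "right_linear A C (regular_bimod A) (counit C)"
    and coassociative: "c \<in> carrier C \<Longrightarrow>
      tensor_assoc A C C C (tensor_map A (tensor A C C) C (comult C) id (comult C c)) =
      tensor_map A C (tensor A C C) id (comult C) (comult C c)"
    and counit_left: "c \<in> carrier C \<Longrightarrow> tensor_lift C (\<lambda>x y. lact C (counit C x) y) (comult C c) = c"
    and counit_right: "c \<in> carrier C \<Longrightarrow> tensor_lift C (\<lambda>x y. ract C x (counit C y)) (comult C c) = c"

text \<open>The left action of a right comodule is ignored.\<close>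

record ('a, 'm, 'c) comod = "('a, 'm) bimod" +
  coact :: "'m \<Rightarrow> ('m, 'c) tens"

locale right_comodule = C?: coring A C + M?: right_module A M
  for A :: "('a, 'j) ring_scheme" (structure)
    and C :: "('a, 'c, 'k) coring_scheme" (structure)
    and M :: "('a, 'm, 'c, 'l) comod_scheme" (structure) +
  assumes coact_right_linear: "right_linear A M (tensor A M C) (coact M)"
    and coact_coassociative: "m \<in> carrier M \<Longrightarrow>
      tensor_assoc A M C C (tensor_map A (tensor A M C) C (coact M) id (coact M m)) =
      tensor_map A M (tensor A C C) id (comult C) (coact M m)"
    and coact_counit: "m \<in> carrier M \<Longrightarrow>
      tensor_lift M (\<lambda>x c. ract M x (counit C c)) (coact M m) = m"

definition colinear ::
    "('a, 'k) ring_scheme \<Rightarrow> ('a, 'c, 'j) coring_scheme \<Rightarrow>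
     ('a, 'm, 'c, 'l) comod_scheme \<Rightarrow> ('a, 'n, 'c, 'i) comod_scheme \<Rightarrow> ('m \<Rightarrow> 'n) \<Rightarrow> bool"
  where "colinear A C M N h \<longleftrightarrow> right_linear A M N h \<and>
     (\<forall>m\<in>carrier M. coact N (h m) = tensor_map A N C h id (coact M m))"

definition comod_Hom ::
    "('a, 'k) ring_scheme \<Rightarrow> ('a, 'c, 'j) coring_scheme \<Rightarrow>
     ('a, 'm, 'c, 'l) comod_scheme \<Rightarrow> ('a, 'n, 'c, 'i) comod_scheme \<Rightarrow> ('m \<Rightarrow> 'n) set"
  where "comod_Hom A C M N = {h \<in> extensional (carrier M). colinear A C M N h}"

text \<open>The coaction on \<open>K\<close> that makes the inclusion colinear is part of the structure of a subcomodule;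
  it is unique if \<open>C\<close> is flat on the left.\<close>

definition subcomodule ::
    "('a, 'k) ring_scheme \<Rightarrow> ('a, 'c, 'j) coring_scheme \<Rightarrow> ('a, 'm, 'c) comod \<Rightarrow> 'm set \<Rightarrow> bool"
  where "subcomodule A C M K \<longleftrightarrow> K \<subseteq> carrier M \<and>
     (\<exists>\<rho>. right_comodule A C (M\<lparr>carrier := K, coact := \<rho>\<rparr>) \<and>
          colinear A C (M\<lparr>carrier := K, coact := \<rho>\<rparr>) M id)"

text \<open>The quotient module \<open>M/K\<close>; \<open>K\<close> is absorbed into \<open>X a\<close> because \<open>{x a | x \<in> X}\<close> may be smaller
  than a coset.\<close>

definition factor_module ::
    "('a, 'm, 'l) bimod_scheme \<Rightarrow> 'm set \<Rightarrow> ('a, 'm set) bimod"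
  where "factor_module M K = \<lparr>carrier = a_rcosets\<^bsub>M\<^esub> K, monoid.mult = undefined, one = undefined,
     zero = K, add = set_add M, lact = undefined,
     ract = (\<lambda>X a. K <+>\<^bsub>M\<^esub> ((\<lambda>x. ract M x a) ` X))\<rparr>"

text \<open>The coaction on \<open>M/K\<close> is the one that makes the projection colinear.\<close>

definition factor_comodule ::
    "('a, 'k) ring_scheme \<Rightarrow> ('a, 'c, 'j) coring_scheme \<Rightarrow> ('a, 'm, 'c) comod \<Rightarrow> 'm set \<Rightarrow>
     ('a, 'm set, 'c) comod"
  where "factor_comodule A C M K = bimod.extend (factor_module M K)
     (comod.fields (\<lambda>X. the_elem
        ((\<lambda>m. tensor_map A (factor_module M K) C (\<lambda>x. K +>\<^bsub>M\<^esub> x) id (coact M m)) ` X)))"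

definition coretractable ::
    "('a, 'k) ring_scheme \<Rightarrow> ('a, 'c, 'j) coring_scheme \<Rightarrow> ('a, 'm, 'c) comod \<Rightarrow> bool"
  where "coretractable A C M \<longleftrightarrow>
     (\<forall>K. subcomodule A C M K \<and> K \<noteq> carrier M \<longrightarrow>
        (\<exists>h \<in> comod_Hom A C (factor_comodule A C M K) M.
           \<exists>X \<in> carrier (factor_comodule A C M K). h X \<noteq> \<zero>\<^bsub>M\<^esub>))"

definition self_cogenerator ::
    "('a, 'k) ring_scheme \<Rightarrow> ('a, 'c, 'j) coring_scheme \<Rightarrow> ('a, 'm, 'c) comod \<Rightarrow> bool"
  where "self_cogenerator A C M \<longleftrightarrow>
     (\<forall>K. subcomodule A C M K \<longrightarrow>
        {X \<in> carrier (factor_comodule A C M K).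
           \<forall>h \<in> comod_Hom A C (factor_comodule A C M K) M. h X = \<zero>\<^bsub>M\<^esub>} =
        {\<zero>\<^bsub>factor_comodule A C M K\<^esub>})"

definition coring_comod :: "('a, 'c, 'k) coring_scheme \<Rightarrow> ('a, 'c, 'c) comod" where
  "coring_comod C = \<lparr>carrier = carrier C, monoid.mult = monoid.mult C, one = one C, zero = zero C,
     add = add C, lact = lact C, ract = ract C, coact = comult C\<rparr>"


section \<open>The dual ring\<close>

text \<open>\<open>harpoon C c f\<close> is \<open>c \<leftharpoonup> f = \<Sum> f(c\<^sub>1)c\<^sub>2\<close>.\<close>

definition harpoon :: "('a, 'c, 'k) coring_scheme \<Rightarrow> 'c \<Rightarrow> ('c \<Rightarrow> 'a) \<Rightarrow> 'c" where
  "harpoon C c f = tensor_lift C (\<lambda>x y. lact C (f x) y) (comult C c)"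

definition dual_ring ::
    "('a, 'k) ring_scheme \<Rightarrow> ('a, 'c, 'j) coring_scheme \<Rightarrow> ('c \<Rightarrow> 'a) ring" where
  "dual_ring A C = \<lparr>carrier = right_Hom A C (regular_bimod A),
     monoid.mult = (\<lambda>f g. \<lambda>c\<in>carrier C. g (harpoon C c f)),
     one = (\<lambda>c\<in>carrier C. counit C c),
     zero = (\<lambda>c\<in>carrier C. \<zero>\<^bsub>A\<^esub>),
     add = (\<lambda>f g. \<lambda>c\<in>carrier C. f c \<oplus>\<^bsub>A\<^esub> g c)\<rparr>"

text \<open>The additive subgroup generated by all \<open>c \<leftharpoonup> s\<close> with \<open>c \<in> C\<close> and \<open>s \<in> S\<close>.\<close>

definition act_set :: "('a, 'c, 'k) coring_scheme \<Rightarrow> ('c \<Rightarrow> 'a) set \<Rightarrow> 'c set" where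
  "act_set C S = generate (add_monoid C) {harpoon C c s | c s. c \<in> carrier C \<and> s \<in> S}"

end

theory Submission
  imports Defs
begin

text \<open>A colinear endomorphism \<open>h\<close> of \<open>C\<close> is \<open>c \<mapsto> c \<leftharpoonup> s\<close> for \<open>s = \<epsilon> \<circ> h\<close>.  For a set \<open>S\<close> of elements of the
  dual ring, \<open>K = C S\<close> is a sum of images of colinear endomorphisms; flatness makes \<open>K \<otimes> C \<rightarrow> C \<otimes> C\<close>
  injective, so that \<open>\<Delta>\<close> restricts to a coaction on \<open>K\<close>.  A colinear map \<open>C/K \<rightarrow> C\<close> is then an element
  \<open>s\<close> of the dual ring with \<open>S * s = 0\<close>.  If \<open>C\<close> is coretractable and \<open>K \<noteq> C\<close>, some such \<open>s\<close> is nonzero;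
  if \<open>C\<close> is self-cogenerator and \<open>x \<notin> K\<close>, some such \<open>s\<close> has \<open>x \<leftharpoonup> s \<noteq> 0\<close>.  Taking for \<open>S\<close> the sets
  \<open>f * D\<close>, \<open>{f}\<close>, \<open>f * D * f\<close> and \<open>{f * f}\<close>, where \<open>D\<close> is the dual ring, gives the four equivalences.\<close>

section \<open>Additive maps\<close>

text \<open>The sufficient directions rest on faithfulness of the action: \<epsilon>(c f) = f(c), so
  f = 0 as soon as C f = 0, and (C S) s is generated by the elements c (t s) with t in S. In the
  converse directions a nonzero s with S s = 0 contradicts primeness or integrality at once. For
  semiprime and reduced rings it is f s that must be nonzero, which is why the self-cogenerator
  property is applied to an element c f outside C S. The technical obstacle is the coaction on K = C
  S. It is found by choosing, for each x in K, a preimage of \<Delta>(x) in K \<otimes> C.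
  Injectivity of K \<otimes> C \<rightarrow> C \<otimes> C makes this choice linear, but
  coassociativity lives in K \<otimes> (C \<otimes> C), where the same argument would ask for
  flatness of C \<otimes> C. It is therefore checked on the generators c s, whose coaction is the
  image of \<Delta>(c) under c \<mapsto> c s on the left factor. Since tensors are cosets and
  \<open>tensor_lift\<close> is defined by \<open>the_elem\<close>, identities between maps out of a
  tensor product are reduced by \<open>tensor_ext\<close> to pure tensors.\<close>

lemma additive_mapI:
  assumes "\<And>x. x \<in> carrier M \<Longrightarrow> h x \<in> carrier N"
    and "\<And>x y. \<lbrakk>x \<in> carrier M; y \<in> carrier M\<rbrakk> \<Longrightarrow> h (x \<oplus>\<^bsub>M\<^esub> y) = h x \<oplus>\<^bsub>N\<^esub> h y"
  shows "additive_map M N h"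
  using assms by (auto simp: additive_map_def)

lemma additive_map_closed:
  "\<lbrakk>additive_map M N h; x \<in> carrier M\<rbrakk> \<Longrightarrow> h x \<in> carrier N"
  by (auto simp: additive_map_def)

lemma additive_map_add:
  "\<lbrakk>additive_map M N h; x \<in> carrier M; y \<in> carrier M\<rbrakk> \<Longrightarrow> h (x \<oplus>\<^bsub>M\<^esub> y) = h x \<oplus>\<^bsub>N\<^esub> h y"
  by (auto simp: additive_map_def)

lemma additive_map_comp:
  "\<lbrakk>additive_map M N h; additive_map N P k\<rbrakk> \<Longrightarrow> additive_map M P (\<lambda>x. k (h x))"
  by (auto simp: additive_map_def Pi_def)

lemma additive_map_group_hom:
  assumes "additive_map M N h" "abelian_group M" "abelian_group N"
  shows "group_hom (add_monoid M) (add_monoid N) h"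
  using assms by (auto simp: additive_map_def group_hom_def group_hom_axioms_def hom_def
      abelian_group.a_group)

lemma additive_map_zero:
  "\<lbrakk>additive_map M N h; abelian_group M; abelian_group N\<rbrakk> \<Longrightarrow> h \<zero>\<^bsub>M\<^esub> = \<zero>\<^bsub>N\<^esub>"
  using group_hom.hom_one[OF additive_map_group_hom] by auto

lemma additive_map_minus:
  "\<lbrakk>additive_map M N h; abelian_group M; abelian_group N; x \<in> carrier M\<rbrakk> \<Longrightarrow> h (\<ominus>\<^bsub>M\<^esub> x) = \<ominus>\<^bsub>N\<^esub> h x"
  using group_hom.hom_inv[OF additive_map_group_hom] by (auto simp: a_inv_def)

text \<open>The elements at which h and k agree are closed under sums and negatives, so agreement on
  generators suffices. \<open>K\<close> is tied to \<open>M\<close> only through its carrier and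
  addition, because it will be a record whose carrier is C S; zero and negatives are therefore taken
  in \<open>M\<close>, and h 0 = 0 is derived from h 0 = h 0 + h 0.\<close>

lemma additive_map_generate_eq:
  assumes M: "abelian_group M" and N: "abelian_group N"
    and S: "S \<subseteq> carrier M" and K: "carrier K = generate (add_monoid M) S" "add K = add M"
    and h: "additive_map K N h" and k: "additive_map K N k"
    and eq: "\<And>x. x \<in> S \<Longrightarrow> h x = k x" and x: "x \<in> carrier K"
  shows "h x = k x"
proof -
  interpret M: abelian_group M by fact
  interpret N: abelian_group N by fact
  have sub: "subgroup (carrier K) (add_monoid M)"
    unfolding K using S by (intro M.add.generate_is_subgroup) simp
  have in_K: "\<zero>\<^bsub>M\<^esub> \<in> carrier K" "x \<in> carrier K \<Longrightarrow> \<ominus>\<^bsub>M\<^esub> x \<in> carrier K"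
    "x \<in> carrier K \<Longrightarrow> x \<in> carrier M" for x
    using subgroup.one_closed[OF sub] subgroup.m_inv_closed[OF sub] subgroup.mem_carrier[OF sub]
    by (auto simp: a_inv_def)
  have zero: "g \<zero>\<^bsub>M\<^esub> = \<zero>\<^bsub>N\<^esub>" if g: "additive_map K N g" for g
    using additive_map_add[OF g in_K(1,1)] additive_map_closed[OF g in_K(1)] K(2)
    by (simp add: N.add.r_cancel_one')
  have minus: "g (\<ominus>\<^bsub>M\<^esub> x) = \<ominus>\<^bsub>N\<^esub> g x" if g: "additive_map K N g" and x: "x \<in> carrier K" for g x
    using additive_map_add[OF g in_K(2)[OF x] x] additive_map_closed[OF g x]
      additive_map_closed[OF g in_K(2)[OF x]] in_K(3)[OF x] zero[OF g]
    by (simp add: K(2) M.l_neg N.minus_equality)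
  from x show ?thesis
    unfolding K(1)
  proof (induction x rule: generate.induct)
    case one
    then show ?case by (simp add: zero[OF h] zero[OF k])
  next
    case (incl x)
    then show ?case by (rule eq)
  next
    case (inv x)
    then have "x \<in> carrier K" unfolding K(1) by (rule generate.incl)
    then show ?case
      using minus[OF h] minus[OF k] eq[OF inv] by (simp add: a_inv_def)
  next
    case (eng x y)
    then show ?case
      using additive_map_add[OF h, of x y] additive_map_add[OF k, of x y] by (simp add: K)
  qed
qed

section \<open>Tensor products\<close>

text \<open>This is the universal property of the free abelian group, written multiplicatively
  because \<open>finsum\<close> and \<open>add_pow\<close> are \<open>finprod\<close> and powers in
  \<open>add_monoid\<close>. A sum may have smaller support than its summands, so all three products
  are taken over the union of the two supports, where the extra exponents are 0.\<close>

lemma (in comm_group) frag_prod_hom: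
  assumes f: "f \<in> S \<rightarrow> carrier G"
  shows "(\<lambda>u. finprod G (\<lambda>p. f p [^] Poly_Mapping.lookup u p) (Poly_Mapping.keys u))
      \<in> hom (free_Abelian_group S) G" (is "?h \<in> _")
proof (rule homI)
  fix u v
  assume uv: "u \<in> carrier (free_Abelian_group S)" "v \<in> carrier (free_Abelian_group S)"
  let ?K = "Poly_Mapping.keys u \<union> Poly_Mapping.keys v"
  have K: "?K \<subseteq> S" using uv by simp
  have *: "?h w = finprod G (\<lambda>p. f p [^] Poly_Mapping.lookup w p) ?K"
    if "Poly_Mapping.keys w \<subseteq> ?K" for w
    using that K f by (intro finprod_mono_neutral_cong_left) (auto simp: in_keys_iff Pi_def subset_iff)
  have "?h (u + v) = finprod G (\<lambda>p. f p [^] Poly_Mapping.lookup u p \<otimes> f p [^] Poly_Mapping.lookup v p) ?K"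
    using K f by (subst *[OF keys_add], intro finprod_cong')
      (auto simp: lookup_add int_pow_mult Pi_def subset_iff)
  also have "\<dots> = ?h u \<otimes> ?h v"
    using K f by (simp add: * finprod_multf Pi_def subset_iff)
  finally show "?h (u \<otimes>\<^bsub>free_Abelian_group S\<^esub> v) = ?h u \<otimes> ?h v" by simp
qed (use f in \<open>auto intro!: finprod_closed\<close>)

lemma (in comm_group) frag_prod_frag_of:
  assumes "f q \<in> carrier G"
  shows "finprod G (\<lambda>p. f p [^] Poly_Mapping.lookup (frag_of q) p) (Poly_Mapping.keys (frag_of q)) = f q"
  using assms by simp

lemma (in abelian_group) add_diff_diff:
  assumes "x \<in> carrier G" "y \<in> carrier G"
  shows "x \<oplus> y \<ominus> x \<ominus> y = \<zero>"
proof -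
  have "x \<oplus> y \<ominus> x \<ominus> y = (x \<oplus> y) \<oplus> \<ominus> (x \<oplus> y)"
    using assms by (simp add: a_minus_def a_assoc minus_add)
  then show ?thesis using assms by (simp only: r_neg a_closed)
qed

section \<open>The tensor product as an abelian group\<close>

lemma tensor_rel_subgroup:
  assumes "right_module A M" "left_module A N"
  shows "subgroup (tensor_rel A M N) (free_Abelian_group (carrier M \<times> carrier N))"
proof -
  interpret M: right_module A M by fact
  interpret N: left_module A N by fact
  have k2: "frag_of p - frag_of q \<in> carrier (free_Abelian_group S)"
    if "p \<in> S" "q \<in> S" for p q S
    using that keys_diff[of "frag_of p" "frag_of q"] by auto
  have k3: "frag_of p - frag_of q - frag_of r \<in> carrier (free_Abelian_group S)"
    if "p \<in> S" "q \<in> S" "r \<in> S" for p q r S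
    using k2[OF that(1,2)] that(3) keys_diff[of "frag_of p - frag_of q" "frag_of r"] by auto
  show ?thesis
    unfolding tensor_rel_def
  proof (rule group.generate_is_subgroup[OF group_free_Abelian_group], intro Un_least subsetI, goal_cases)
    case (1 u)
    then obtain x x' y where u: "u = frag_of (x \<oplus>\<^bsub>M\<^esub> x', y) - frag_of (x, y) - frag_of (x', y)"
      and "x \<in> carrier M" "x' \<in> carrier M" "y \<in> carrier N" by blast
    then show ?case unfolding u by (intro k3) auto
  next
    case (2 u)
    then obtain x y y' where u: "u = frag_of (x, y \<oplus>\<^bsub>N\<^esub> y') - frag_of (x, y) - frag_of (x, y')"
      and "x \<in> carrier M" "y \<in> carrier N" "y' \<in> carrier N" by blast
    then show ?case unfolding u by (intro k3) auto
  next
    case (3 u)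
    then obtain x a y where u: "u = frag_of (ract M x a, y) - frag_of (x, lact N a y)"
      and "x \<in> carrier M" "a \<in> carrier A" "y \<in> carrier N" by blast
    then show ?case unfolding u by (intro k2) (auto simp: M.ract_closed N.lact_closed)
  qed
qed

lemma carrier_tensor:
  "carrier (tensor A M N) = rcosets\<^bsub>free_Abelian_group (carrier M \<times> carrier N)\<^esub> (tensor_rel A M N)"
  by (simp add: tensor_def tensor_group_def Let_def FactGroup_def ring.defs)

lemma add_monoid_tensor_group:
  "add_monoid (tensor_group A M N) = free_Abelian_group (carrier M \<times> carrier N) Mod tensor_rel A M N"
  by (simp add: tensor_group_def Let_def FactGroup_def ring.defs)

text \<open>\<open>tensor_map\<close> lands in the bare \<open>tensor_group\<close>, because the
  actions of \<open>tensor\<close> are themselves tensor maps. These rules move all further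
  reasoning to \<open>tensor\<close>.\<close>

lemma tensor_group_simps [simp]:
  "carrier (tensor_group A M N) = carrier (tensor A M N)"
  "zero (tensor_group A M N) = zero (tensor A M N)"
  "add (tensor_group A M N) = add (tensor A M N)"
  by (simp_all add: tensor_def ring.defs)

lemma abelian_group_cong:
  assumes "abelian_group M"
    and "carrier N = carrier M" "zero N = zero M" "add N = add M"
  shows "abelian_group N"
proof -
  interpret M: abelian_group M by fact
  show ?thesis
    by (rule abelian_groupI) (auto simp: assms M.a_assoc intro: M.a_comm M.l_neg)
qed

lemma abelian_group_tensor:
  assumes "right_module A M" "left_module A N"
  shows "abelian_group (tensor A M N)"
proof -
  have "comm_group (add_monoid (tensor_group A M N))"
    unfolding add_monoid_tensor_group
    by (simp add: comm_group.abelian_FactGroup abelian_free_Abelian_group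
      tensor_rel_subgroup assms)
  then have "abelian_group (tensor_group A M N)"
    unfolding abelian_group_def abelian_group_axioms_def abelian_monoid_def
    by (blast intro: comm_group.axioms(1))
  then show ?thesis
    by (rule abelian_group_cong) simp_all
qed

lemma abelian_group_tensor_group:
  assumes "right_module A M" "left_module A N"
  shows "abelian_group (tensor_group A M N)"
  using abelian_group_tensor[OF assms] by (rule abelian_group_cong) simp_all

lemma lact_tensor: "lact (tensor A M N) a t = tensor_map A M N (lact M a) id t"
  and ract_tensor: "ract (tensor A M N) t a = tensor_map A M N id (\<lambda>y. ract N y a) t"
  by (simp_all add: tensor_def ring.defs bimod.defs del: tensor_group_simps)

section \<open>The universal property of the tensor product\<close>

text \<open>The hypotheses under which \<open>tensor_lift P b\<close> is well defined.
  \<open>P\<close> is only an abelian group, so the same locale serves lifts into modules and into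
  tensor products.\<close>

locale balanced_map =
  fixes A :: "('a, 'j) ring_scheme" and M :: "('a, 'm, 'k) bimod_scheme"
    and N :: "('a, 'n, 'l) bimod_scheme" and P :: "('p, 'i) ring_scheme" and b :: "'m \<Rightarrow> 'n \<Rightarrow> 'p"
  assumes right_module: "right_module A M" and left_module: "left_module A N"
    and abelian_group: "abelian_group P"
    and closed: "\<lbrakk>x \<in> carrier M; y \<in> carrier N\<rbrakk> \<Longrightarrow> b x y \<in> carrier P"
    and add_left: "\<lbrakk>x \<in> carrier M; x' \<in> carrier M; y \<in> carrier N\<rbrakk> \<Longrightarrow>
      b (x \<oplus>\<^bsub>M\<^esub> x') y = b x y \<oplus>\<^bsub>P\<^esub> b x' y"
    and add_right: "\<lbrakk>x \<in> carrier M; y \<in> carrier N; y' \<in> carrier N\<rbrakk> \<Longrightarrow>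
      b x (y \<oplus>\<^bsub>N\<^esub> y') = b x y \<oplus>\<^bsub>P\<^esub> b x y'"
    and balanced: "\<lbrakk>x \<in> carrier M; a \<in> carrier A; y \<in> carrier N\<rbrakk> \<Longrightarrow>
      b (ract M x a) y = b x (lact N a y)"
begin

abbreviation "F \<equiv> free_Abelian_group (carrier M \<times> carrier N)"

text \<open>The \<int>-linear extension of b to the free abelian group; \<open>tensor_lift\<close>
  takes the single value of this function on a coset.\<close>

definition frag_lift :: "('m \<times> 'n \<Rightarrow>\<^sub>0 int) \<Rightarrow> 'p" where
  "frag_lift u = (\<Oplus>\<^bsub>P\<^esub>p\<in>Poly_Mapping.keys u. add_pow P (Poly_Mapping.lookup u p) (b (fst p) (snd p)))"

lemma frag_lift_hom: "frag_lift \<in> hom F (add_monoid P)"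
proof -
  interpret comm_group "add_monoid P"
    using abelian_group by (rule abelian_group.a_comm_group)
  show ?thesis
    unfolding frag_lift_def[abs_def] finsum_def add_pow_def
    by (rule frag_prod_hom) (use closed in auto)
qed

lemma group_hom_frag_lift: "group_hom F (add_monoid P) frag_lift"
  by (simp add: group_hom_def group_hom_axioms_def frag_lift_hom abelian_group
      abelian_group.a_group)

lemma frag_lift_frag_of:
  assumes "x \<in> carrier M" "y \<in> carrier N"
  shows "frag_lift (frag_of (x, y)) = b x y"
proof -
  interpret comm_group "add_monoid P"
    using abelian_group by (rule abelian_group.a_comm_group)
  show ?thesis
    using closed[OF assms] frag_prod_frag_of[of "\<lambda>p. b (fst p) (snd p)" "(x,y)"]
    by (simp add: frag_lift_def finsum_def add_pow_def)
qed

lemma frag_lift_diff: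
  assumes "Poly_Mapping.keys u \<subseteq> carrier M \<times> carrier N" "Poly_Mapping.keys v \<subseteq> carrier M \<times> carrier N"
  shows "frag_lift (u - v) = frag_lift u \<ominus>\<^bsub>P\<^esub> frag_lift v"
proof -
  interpret group_hom F "add_monoid P" frag_lift by (rule group_hom_frag_lift)
  show ?thesis
    using hom_mult[of u "-v"] hom_inv[of v] assms
    by (simp add: a_minus_def a_inv_def)
qed

text \<open>The kernel of the extension is a subgroup, so it is enough that it contains the three
  families generating \<open>tensor_rel\<close>: additivity in each argument accounts for the first
  two, balancing for the third.\<close>

lemma frag_lift_tensor_rel:
  assumes "u \<in> tensor_rel A M N"
  shows "frag_lift u = \<zero>\<^bsub>P\<^esub>"
proof -
  note hom_closed = group_hom.hom_closed[OF group_hom_frag_lift, simplified]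
  interpret P: abelian_group P by (rule abelian_group)
  interpret M: right_module A M by (rule right_module)
  interpret N: left_module A N by (rule left_module)
  have k: "Poly_Mapping.keys (frag_of p - frag_of q) \<subseteq> S"
    if "p \<in> S" "q \<in> S" for p q and S :: "('m \<times> 'n) set"
    using that by (auto dest!: subsetD[OF keys_diff] split: if_splits)
  have three: "frag_of p - frag_of q - frag_of r \<in> kernel F (add_monoid P) frag_lift"
    if "p \<in> carrier M \<times> carrier N" "q \<in> carrier M \<times> carrier N" "r \<in> carrier M \<times> carrier N"
      and "frag_lift (frag_of p) = frag_lift (frag_of q) \<oplus>\<^bsub>P\<^esub> frag_lift (frag_of r)" for p q r
  proof -
    have "frag_lift (frag_of q) \<in> carrier P" "frag_lift (frag_of r) \<in> carrier P"
      using that hom_closed by auto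
    moreover have "Poly_Mapping.keys (frag_of p - frag_of q - frag_of r) \<subseteq> carrier M \<times> carrier N"
      using keys_diff[of "frag_of p - frag_of q" "frag_of r"] k[OF that(1,2)] that(3) by auto
    ultimately show ?thesis
      using that by (simp add: kernel_def frag_lift_diff k P.add_diff_diff)
  qed
  have two: "frag_of p - frag_of q \<in> kernel F (add_monoid P) frag_lift"
    if "p \<in> carrier M \<times> carrier N" "q \<in> carrier M \<times> carrier N"
      and "frag_lift (frag_of p) = frag_lift (frag_of q)" for p q
  proof -
    have "frag_lift (frag_of q) \<in> carrier P"
      using that hom_closed by auto
    then show ?thesis
      using that by (simp add: kernel_def frag_lift_diff k P.r_neg a_minus_def)
  qed
  have "tensor_rel A M N \<subseteq> kernel F (add_monoid P) frag_lift"
    unfolding tensor_rel_def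
  proof (rule group.generate_subgroup_incl[OF group_free_Abelian_group _ group_hom.subgroup_kernel[OF group_hom_frag_lift]], intro Un_least subsetI, goal_cases)
    case (1 u)
    then obtain x x' y where "u = frag_of (x \<oplus>\<^bsub>M\<^esub> x', y) - frag_of (x, y) - frag_of (x', y)"
      and "x \<in> carrier M" "x' \<in> carrier M" "y \<in> carrier N" by blast
    then show ?case
      by (simp add: three frag_lift_frag_of add_left)
  next
    case (2 u)
    then obtain x y y' where "u = frag_of (x, y \<oplus>\<^bsub>N\<^esub> y') - frag_of (x, y) - frag_of (x, y')"
      and "x \<in> carrier M" "y \<in> carrier N" "y' \<in> carrier N" by blast
    then show ?case
      by (simp add: three frag_lift_frag_of add_right)
  next
    case (3 u)
    then obtain x a y where "u = frag_of (ract M x a, y) - frag_of (x, lact N a y)"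
      and "x \<in> carrier M" "a \<in> carrier A" "y \<in> carrier N" by blast
    then show ?case
      by (simp add: two frag_lift_frag_of balanced M.ract_closed N.lact_closed)
  qed
  then show ?thesis using assms by (auto simp: kernel_def)
qed

end

lemma tensor_coset_hom:
  assumes "right_module A M" "left_module A N"
  shows "group_hom (free_Abelian_group (carrier M \<times> carrier N)) (add_monoid (tensor A M N))
    (\<lambda>u. tensor_rel A M N #>\<^bsub>free_Abelian_group (carrier M \<times> carrier N)\<^esub> u)"
    (is "group_hom ?F ?T ?q")
proof -
  have "tensor_rel A M N \<lhd> ?F"
    by (simp add: tensor_rel_subgroup assms comm_group.normal_iff_subgroup abelian_free_Abelian_group)
  then have "?q \<in> hom ?F (add_monoid (tensor_group A M N))"
    unfolding add_monoid_tensor_group by (rule normal.r_coset_hom_Mod)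
  then show ?thesis
    using abelian_group_tensor[OF assms]
    by (simp add: group_hom_def group_hom_axioms_def hom_def abelian_group.a_group)
qed

lemma pure_tensor_closed:
  assumes "right_module A M" "left_module A N" "x \<in> carrier M" "y \<in> carrier N"
  shows "pure_tensor A M N x y \<in> carrier (tensor A M N)"
  unfolding pure_tensor_def
  using group_hom.hom_closed[OF tensor_coset_hom[OF assms(1,2)], of "frag_of (x, y)"] assms by simp

lemma tensor_cases:
  assumes "t \<in> carrier (tensor A M N)"
  obtains u where "Poly_Mapping.keys u \<subseteq> carrier M \<times> carrier N"
    and "t = tensor_rel A M N #>\<^bsub>free_Abelian_group (carrier M \<times> carrier N)\<^esub> u"
  using assms by (auto simp: carrier_tensor RCOSETS_def)

text \<open>Pure tensors generate the tensor product: both maps, composed with the quotient map, are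
  homomorphisms on the free abelian group and agree on its basis. The induction on that group
  proceeds by differences, hence the auxiliary fact \<open>diff\<close>. Most later identities about
  actions, coactions and contractions are proved with this rule.\<close>

lemma tensor_ext:
  assumes M: "right_module A M" and N: "left_module A N" and Q: "abelian_group Q"
    and h: "additive_map (tensor A M N) Q h" and k: "additive_map (tensor A M N) Q k"
    and eq: "\<And>x y. \<lbrakk>x \<in> carrier M; y \<in> carrier N\<rbrakk> \<Longrightarrow>
      h (pure_tensor A M N x y) = k (pure_tensor A M N x y)"
    and t: "t \<in> carrier (tensor A M N)"
  shows "h t = k t"
proof -
  let ?F = "free_Abelian_group (carrier M \<times> carrier N)"
  let ?q = "\<lambda>u. tensor_rel A M N #>\<^bsub>?F\<^esub> u"
  note T = abelian_group_tensor[OF M N]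
  note q = tensor_coset_hom[OF M N]
  have diff: "g (?q (u - v)) = g (?q u) \<ominus>\<^bsub>Q\<^esub> g (?q v)"
    if "additive_map (tensor A M N) Q g"
      and "Poly_Mapping.keys u \<subseteq> carrier M \<times> carrier N"
      and "Poly_Mapping.keys v \<subseteq> carrier M \<times> carrier N" for g u v
  proof -
    have "g \<circ> ?q \<in> hom ?F (add_monoid Q)"
      using q additive_map_group_hom[OF that(1) T Q] hom_compose
      unfolding group_hom_def group_hom_axioms_def by blast
    then interpret group_hom ?F "add_monoid Q" "g \<circ> ?q"
      using Q by (simp add: group_hom_def group_hom_axioms_def abelian_group.a_group)
    show ?thesis
      using hom_mult[of u "-v"] hom_inv[of v] that by (simp add: a_minus_def a_inv_def)
  qed
  obtain u where u: "Poly_Mapping.keys u \<subseteq> carrier M \<times> carrier N" "t = ?q u"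
    using t by (rule tensor_cases)
  have "h (?q u) = k (?q u)"
  proof (rule free_Abelian_group_induct[OF u(1), where P = "\<lambda>u. h (?q u) = k (?q u)"], goal_cases)
    case 1
    have "?q 0 = \<zero>\<^bsub>tensor A M N\<^esub>"
      using group_hom.hom_one[OF q] by simp
    then show ?case
      using additive_map_zero[OF h T Q] additive_map_zero[OF k T Q] by simp
  next
    case (2 u v)
    then show ?case by (simp add: diff[OF h] diff[OF k])
  next
    case (3 p)
    then show ?case using eq by (auto simp: pure_tensor_def)
  qed
  then show ?thesis by (simp add: u(2))
qed

text \<open>Two representatives give the same coset when their difference is a relation; each of the
  three laws exhibits a generator of \<open>tensor_rel\<close> as such a difference.\<close>

lemma pure_tensor_balanced:
  assumes "right_module A M" "left_module A N"
  shows "balanced_map A M N (tensor A M N) (pure_tensor A M N)"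
proof -
  interpret M: right_module A M by fact
  interpret N: left_module A N by fact
  let ?F = "free_Abelian_group (carrier M \<times> carrier N)"
  interpret F: comm_group ?F by (rule abelian_free_Abelian_group)
  note sub = tensor_rel_subgroup[OF assms]
  note q = tensor_coset_hom[OF assms]
  have eq: "tensor_rel A M N #>\<^bsub>?F\<^esub> u = tensor_rel A M N #>\<^bsub>?F\<^esub> v"
    if "u - v \<in> tensor_rel A M N" "Poly_Mapping.keys v \<subseteq> carrier M \<times> carrier N" for u v
  proof -
    have "u \<in> tensor_rel A M N #>\<^bsub>?F\<^esub> v"
      using that(1) by (auto simp: r_coset_def intro!: bexI[of _ "u - v"])
    then show ?thesis using F.repr_independence[OF _ _ sub] that(2) by auto
  qed
  have add: "(tensor_rel A M N #>\<^bsub>?F\<^esub> u) \<oplus>\<^bsub>tensor A M N\<^esub> (tensor_rel A M N #>\<^bsub>?F\<^esub> v)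
      = tensor_rel A M N #>\<^bsub>?F\<^esub> (u + v)"
    if "Poly_Mapping.keys u \<subseteq> carrier M \<times> carrier N"
      "Poly_Mapping.keys v \<subseteq> carrier M \<times> carrier N" for u v
    using group_hom.hom_mult[OF q, of u v] that by simp
  have k: "Poly_Mapping.keys (frag_of p + frag_of q) \<subseteq> S" if "p \<in> S" "q \<in> S" for p q S
    using that keys_add[of "frag_of p" "frag_of q"] by auto
  show ?thesis
  proof (rule balanced_map.intro)
    fix x x' y assume *: "x \<in> carrier M" "x' \<in> carrier M" "y \<in> carrier N"
    then have "frag_of (x \<oplus>\<^bsub>M\<^esub> x', y) - frag_of (x, y) - frag_of (x', y) \<in> tensor_rel A M N"
      unfolding tensor_rel_def by (intro generate.incl) blast
    then show "pure_tensor A M N (x \<oplus>\<^bsub>M\<^esub> x') y =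
        pure_tensor A M N x y \<oplus>\<^bsub>tensor A M N\<^esub> pure_tensor A M N x' y"
      using * by (simp add: pure_tensor_def add k eq diff_diff_eq)
  next
    fix x y y' assume *: "x \<in> carrier M" "y \<in> carrier N" "y' \<in> carrier N"
    then have "frag_of (x, y \<oplus>\<^bsub>N\<^esub> y') - frag_of (x, y) - frag_of (x, y') \<in> tensor_rel A M N"
      unfolding tensor_rel_def by (intro generate.incl) blast
    then show "pure_tensor A M N x (y \<oplus>\<^bsub>N\<^esub> y') =
        pure_tensor A M N x y \<oplus>\<^bsub>tensor A M N\<^esub> pure_tensor A M N x y'"
      using * by (simp add: pure_tensor_def add k eq diff_diff_eq)
  next
    fix x a y assume *: "x \<in> carrier M" "a \<in> carrier A" "y \<in> carrier N"
    then have "frag_of (ract M x a, y) - frag_of (x, lact N a y) \<in> tensor_rel A M N"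
      unfolding tensor_rel_def by (intro generate.incl) blast
    then show "pure_tensor A M N (ract M x a) y = pure_tensor A M N x (lact N a y)"
      unfolding pure_tensor_def using * by (intro eq) (auto simp: N.lact_closed)
  qed (auto intro: assms abelian_group_tensor pure_tensor_closed)
qed

context balanced_map
begin

text \<open>Well-definedness of the lift: elements of one coset differ by relations, which
  \<open>frag_lift\<close> kills, so its image of the coset is a singleton and
  \<open>the_elem\<close> returns its member.\<close>

lemma tensor_lift_coset:
  assumes "Poly_Mapping.keys u \<subseteq> carrier M \<times> carrier N"
  shows "tensor_lift P b (tensor_rel A M N #>\<^bsub>F\<^esub> u) = frag_lift u"
proof -
  note sub = tensor_rel_subgroup[OF right_module left_module]
  have "frag_lift (r + u) = frag_lift u" if "r \<in> tensor_rel A M N" for r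
  proof -
    have "Poly_Mapping.keys r \<subseteq> carrier M \<times> carrier N"
      using subgroup.mem_carrier[OF sub that] by simp
    then show ?thesis
      using group_hom.hom_mult[OF group_hom_frag_lift, of r u] assms frag_lift_tensor_rel[OF that]
        group_hom.hom_closed[OF group_hom_frag_lift, of u] abelian_group
      by (simp add: abelian_monoid.l_zero[OF abelian_group.axioms(1)])
  qed
  then have "frag_lift ` (tensor_rel A M N #>\<^bsub>F\<^esub> u) = {frag_lift u}"
    using subgroup.one_closed[OF sub] by (force simp: r_coset_def)
  then show ?thesis
    unfolding tensor_lift_def frag_lift_def[symmetric] by simp
qed

lemma tensor_lift_additive: "additive_map (tensor A M N) P (tensor_lift P b)"
proof (rule additive_mapI)
  note q = tensor_coset_hom[OF right_module left_module]
  fix s assume s: "s \<in> carrier (tensor A M N)"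
  then obtain u where u: "Poly_Mapping.keys u \<subseteq> carrier M \<times> carrier N"
    "s = tensor_rel A M N #>\<^bsub>F\<^esub> u"
    by (rule tensor_cases)
  show "tensor_lift P b s \<in> carrier P"
    using u group_hom.hom_closed[OF group_hom_frag_lift, of u] by (simp add: tensor_lift_coset)
  fix t assume t: "t \<in> carrier (tensor A M N)"
  then obtain v where v: "Poly_Mapping.keys v \<subseteq> carrier M \<times> carrier N"
    "t = tensor_rel A M N #>\<^bsub>F\<^esub> v"
    by (rule tensor_cases)
  have "s \<oplus>\<^bsub>tensor A M N\<^esub> t = tensor_rel A M N #>\<^bsub>F\<^esub> (u + v)"
    using group_hom.hom_mult[OF q, of u v] u v by simp
  moreover have "Poly_Mapping.keys (u + v) \<subseteq> carrier M \<times> carrier N"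
    using keys_add[of u v] u v by auto
  ultimately show "tensor_lift P b (s \<oplus>\<^bsub>tensor A M N\<^esub> t) = tensor_lift P b s \<oplus>\<^bsub>P\<^esub> tensor_lift P b t"
    using u v group_hom.hom_mult[OF group_hom_frag_lift, of u v] by (simp add: tensor_lift_coset)
qed

lemma tensor_lift_pure:
  assumes "x \<in> carrier M" "y \<in> carrier N"
  shows "tensor_lift P b (pure_tensor A M N x y) = b x y"
  using assms by (simp add: pure_tensor_def tensor_lift_coset frag_lift_frag_of)

end

lemma right_linear_additive: "right_linear A M N h \<Longrightarrow> additive_map M N h"
  and left_linear_additive: "left_linear A M N h \<Longrightarrow> additive_map M N h"
  by (simp_all add: right_linear_def left_linear_def)

lemmas right_linear_closed = additive_map_closed[OF right_linear_additive]
  and right_linear_add = additive_map_add[OF right_linear_additive]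
  and left_linear_closed = additive_map_closed[OF left_linear_additive]
  and left_linear_add = additive_map_add[OF left_linear_additive]

lemma right_linear_ract:
  "\<lbrakk>right_linear A M N h; x \<in> carrier M; a \<in> carrier A\<rbrakk> \<Longrightarrow> h (ract M x a) = ract N (h x) a"
  by (simp add: right_linear_def)

lemma left_linear_lact:
  "\<lbrakk>left_linear A M N h; x \<in> carrier M; a \<in> carrier A\<rbrakk> \<Longrightarrow> h (lact M a x) = lact N a (h x)"
  by (simp add: left_linear_def)

lemma right_linearI:
  assumes "additive_map M N h"
    and "\<And>x a. \<lbrakk>x \<in> carrier M; a \<in> carrier A\<rbrakk> \<Longrightarrow> h (ract M x a) = ract N (h x) a"
  shows "right_linear A M N h"
  using assms by (simp add: right_linear_def)

lemma left_linearI: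
  assumes "additive_map M N h"
    and "\<And>x a. \<lbrakk>x \<in> carrier M; a \<in> carrier A\<rbrakk> \<Longrightarrow> h (lact M a x) = lact N a (h x)"
  shows "left_linear A M N h"
  using assms by (simp add: left_linear_def)

lemma additive_map_id [simp]: "additive_map M M id" "additive_map M M (\<lambda>x. x)"
  by (simp_all add: additive_map_def)

lemma right_linear_id [simp]: "right_linear A M M id"
  by (simp add: right_linear_def)

lemma left_linear_id [simp]: "left_linear A M M id"
  by (simp add: left_linear_def)

lemma right_linear_comp:
  assumes "right_linear A M N h" "right_linear A N P k"
  shows "right_linear A M P (\<lambda>x. k (h x))"
  using assms additive_map_comp[of M N h P k]
  by (auto simp: right_linear_def additive_map_closed[of M N h])

lemma left_linear_comp:
  assumes "left_linear A M N h" "left_linear A N P k"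
  shows "left_linear A M P (\<lambda>x. k (h x))"
  using assms additive_map_comp[of M N h P k]
  by (auto simp: left_linear_def additive_map_closed[of M N h])

lemma (in bimodule) right_linear_lact: "a \<in> carrier A \<Longrightarrow> right_linear A M M (lact M a)"
  by (intro right_linearI additive_mapI) (simp_all add: lact_closed lact_add lact_ract)

lemma (in bimodule) left_linear_ract: "a \<in> carrier A \<Longrightarrow> left_linear A M M (\<lambda>x. ract M x a)"
  by (intro left_linearI additive_mapI) (simp_all add: ract_closed ract_add lact_ract)

section \<open>Functoriality of the tensor product\<close>

locale tensor_linear =
  fixes A :: "('a, 'j) ring_scheme"
    and M0 :: "('a, 'm0, 'k0) bimod_scheme" and N0 :: "('a, 'n0, 'l0) bimod_scheme"
    and M :: "('a, 'm, 'k) bimod_scheme" and N :: "('a, 'n, 'l) bimod_scheme" and f g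
  assumes modules: "right_module A M0" "left_module A N0" "right_module A M" "left_module A N"
    and f: "right_linear A M0 M f" and g: "left_linear A N0 N g"
begin

lemma balanced: "balanced_map A M0 N0 (tensor_group A M N) (\<lambda>x y. pure_tensor A M N (f x) (g y))"
proof -
  interpret p: balanced_map A M N "tensor A M N" "pure_tensor A M N"
    using modules by (intro pure_tensor_balanced)
  show ?thesis
    by (rule balanced_map.intro) (simp_all add: modules abelian_group_tensor_group p.closed p.add_left p.add_right p.balanced
        right_linear_closed[OF f] right_linear_add[OF f] right_linear_ract[OF f]
        left_linear_closed[OF g] left_linear_add[OF g] left_linear_lact[OF g])
qed

lemma tensor_map_additive: "additive_map (tensor A M0 N0) (tensor A M N) (tensor_map A M N f g)"
  using balanced_map.tensor_lift_additive[OF balanced]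
  by (simp add: additive_map_def tensor_map_def)

lemmas tensor_map_closed = additive_map_closed[OF tensor_map_additive]
lemmas tensor_map_add = additive_map_add[OF tensor_map_additive]

lemma tensor_map_pure:
  assumes "x \<in> carrier M0" "y \<in> carrier N0"
  shows "tensor_map A M N f g (pure_tensor A M0 N0 x y) = pure_tensor A M N (f x) (g y)"
  using balanced_map.tensor_lift_pure[OF balanced assms] by (simp add: tensor_map_def)

end

lemma tensor_map_comp:
  assumes "tensor_linear A M0 N0 M N f g" "tensor_linear A M N P Q f' g'"
    and "t \<in> carrier (tensor A M0 N0)"
  shows "tensor_map A P Q f' g' (tensor_map A M N f g t) =
    tensor_map A P Q (\<lambda>x. f' (f x)) (\<lambda>y. g' (g y)) t"
proof -
  interpret s: tensor_linear A M0 N0 M N f g by fact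
  interpret t: tensor_linear A M N P Q f' g' by fact
  interpret u: tensor_linear A M0 N0 P Q "\<lambda>x. f' (f x)" "\<lambda>y. g' (g y)"
    using s.modules t.modules
    by (intro tensor_linear.intro right_linear_comp[OF s.f t.f] left_linear_comp[OF s.g t.g])
  show ?thesis
    by (rule tensor_ext[OF s.modules(1,2) abelian_group_tensor[OF t.modules(3,4)]
          additive_map_comp[OF s.tensor_map_additive t.tensor_map_additive]
          u.tensor_map_additive _ assms(3)])
      (simp add: s.tensor_map_pure t.tensor_map_pure u.tensor_map_pure
        right_linear_closed[OF s.f] left_linear_closed[OF s.g])
qed

lemma tensor_map_id:
  assumes "right_module A M" "left_module A N" "t \<in> carrier (tensor A M N)"
  shows "tensor_map A M N id id t = t"
proof -
  interpret tensor_linear A M N M N id id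
    using assms by (simp add: tensor_linear_def)
  show ?thesis
    by (rule tensor_ext[OF assms(1,2) abelian_group_tensor[OF assms(1,2)] tensor_map_additive
          additive_map_id(2) _ assms(3)]) (simp add: tensor_map_pure)
qed

lemma additive_map_sum:
  assumes "abelian_group N" "additive_map M N h" "additive_map M N k"
  shows "additive_map M N (\<lambda>x. h x \<oplus>\<^bsub>N\<^esub> k x)"
proof (rule additive_mapI)
  interpret N: abelian_group N by fact
  fix x y assume *: "x \<in> carrier M" "y \<in> carrier M"
  note c = additive_map_closed[OF assms(2)] additive_map_closed[OF assms(3)]
  show "h x \<oplus>\<^bsub>N\<^esub> k x \<in> carrier N" using * c by simp
  show "h (x \<oplus>\<^bsub>M\<^esub> y) \<oplus>\<^bsub>N\<^esub> k (x \<oplus>\<^bsub>M\<^esub> y) = h x \<oplus>\<^bsub>N\<^esub> k x \<oplus>\<^bsub>N\<^esub> (h y \<oplus>\<^bsub>N\<^esub> k y)"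
    using * c by (simp add: additive_map_add[OF assms(2)] additive_map_add[OF assms(3)] N.a_ac)
qed

section \<open>Module structures on a tensor product\<close>

lemma tensor_linear_lact:
  assumes "bimodule A M" "left_module A N" "a \<in> carrier A"
  shows "tensor_linear A M N M N (lact M a) id"
  using assms by (simp add: tensor_linear_def bimodule.axioms bimodule.right_linear_lact)

lemma tensor_linear_ract:
  assumes "right_module A M" "bimodule A N" "a \<in> carrier A"
  shows "tensor_linear A M N M N id (\<lambda>y. ract N y a)"
  using assms by (simp add: tensor_linear_def bimodule.axioms bimodule.left_linear_ract)

lemma lact_tensor_additive:
  assumes "bimodule A M" "left_module A N" "a \<in> carrier A"
  shows "additive_map (tensor A M N) (tensor A M N) (lact (tensor A M N) a)"
  unfolding lact_tensor[abs_def]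
  using assms by (intro tensor_linear.tensor_map_additive tensor_linear_lact)

lemma ract_tensor_additive:
  assumes "right_module A M" "bimodule A N" "a \<in> carrier A"
  shows "additive_map (tensor A M N) (tensor A M N) (\<lambda>t. ract (tensor A M N) t a)"
  unfolding ract_tensor[abs_def]
  using assms by (intro tensor_linear.tensor_map_additive tensor_linear_ract)

lemma lact_pure_tensor:
  assumes "bimodule A M" "left_module A N" "a \<in> carrier A" "x \<in> carrier M" "y \<in> carrier N"
  shows "lact (tensor A M N) a (pure_tensor A M N x y) = pure_tensor A M N (lact M a x) y"
  using tensor_linear.tensor_map_pure[OF tensor_linear_lact] assms by (simp add: lact_tensor)

lemma ract_pure_tensor:
  assumes "right_module A M" "bimodule A N" "a \<in> carrier A" "x \<in> carrier M" "y \<in> carrier N"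
  shows "ract (tensor A M N) (pure_tensor A M N x y) a = pure_tensor A M N x (ract N y a)"
  using tensor_linear.tensor_map_pure[OF tensor_linear_ract] assms by (simp add: ract_tensor)

text \<open>Each module law is an equation between additive maps in t, so it may be checked on pure
  tensors, where it becomes the corresponding law of the left factor.\<close>

lemma left_module_tensor:
  assumes M: "bimodule A M" and N: "left_module A N"
  shows "left_module A (tensor A M N)"
proof -
  interpret M: bimodule A M by fact
  interpret N: left_module A N by fact
  have R: "right_module A M" by (rule M.right_module_axioms)
  let ?T = "tensor A M N"
  interpret T: abelian_group ?T by (rule abelian_group_tensor[OF R N])
  interpret p: balanced_map A M N ?T "pure_tensor A M N"
    by (rule pure_tensor_balanced[OF R N])
  note add = lact_tensor_additive[OF M N]
  note ext = tensor_ext[OF R N T.abelian_group_axioms]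
  show ?thesis
  proof (intro left_module.intro left_module_axioms.intro M.ring_axioms T.abelian_group_axioms)
    fix a t assume a: "a \<in> carrier A" and t: "t \<in> carrier ?T"
    show "lact ?T a t \<in> carrier ?T" using additive_map_closed[OF add[OF a] t] .
    fix u assume u: "u \<in> carrier ?T"
    show "lact ?T a (t \<oplus>\<^bsub>?T\<^esub> u) = lact ?T a t \<oplus>\<^bsub>?T\<^esub> lact ?T a u"
      using additive_map_add[OF add[OF a] t u] .
  next
    fix a b t assume ab: "a \<in> carrier A" "b \<in> carrier A" and t: "t \<in> carrier ?T"
    show "lact ?T (a \<oplus>\<^bsub>A\<^esub> b) t = lact ?T a t \<oplus>\<^bsub>?T\<^esub> lact ?T b t"
      by (rule ext[OF _ additive_map_sum[OF T.abelian_group_axioms] _ t])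
        (use ab in \<open>simp_all add: add lact_pure_tensor M N M.lact_add_scalar p.add_left M.lact_closed\<close>)
    show "lact ?T (a \<otimes>\<^bsub>A\<^esub> b) t = lact ?T a (lact ?T b t)"
      by (rule ext[OF _ additive_map_comp[of ?T ?T "lact ?T b" ?T "lact ?T a"] _ t])
        (use ab in \<open>simp_all add: add lact_pure_tensor M N M.lact_mult M.lact_closed\<close>)
  next
    fix t assume t: "t \<in> carrier ?T"
    show "lact ?T \<one>\<^bsub>A\<^esub> t = t"
      by (rule ext[OF _ additive_map_id(2) _ t])
        (simp_all add: add lact_pure_tensor M N M.lact_one)
  qed
qed

lemma right_module_tensor:
  assumes M: "right_module A M" and N: "bimodule A N"
  shows "right_module A (tensor A M N)"
proof -
  interpret M: right_module A M by fact
  interpret N: bimodule A N by fact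
  have L: "left_module A N" by (rule N.left_module_axioms)
  let ?T = "tensor A M N"
  interpret T: abelian_group ?T by (rule abelian_group_tensor[OF M L])
  interpret p: balanced_map A M N ?T "pure_tensor A M N"
    by (rule pure_tensor_balanced[OF M L])
  note add = ract_tensor_additive[OF M N]
  note ext = tensor_ext[OF M L T.abelian_group_axioms]
  show ?thesis
  proof (intro right_module.intro right_module_axioms.intro M.ring_axioms T.abelian_group_axioms)
    fix a t assume a: "a \<in> carrier A" and t: "t \<in> carrier ?T"
    show "ract ?T t a \<in> carrier ?T" using additive_map_closed[OF add[OF a] t] .
    fix u assume u: "u \<in> carrier ?T"
    show "ract ?T (t \<oplus>\<^bsub>?T\<^esub> u) a = ract ?T t a \<oplus>\<^bsub>?T\<^esub> ract ?T u a"
      using additive_map_add[OF add[OF a] t u] .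
  next
    fix a b t assume ab: "a \<in> carrier A" "b \<in> carrier A" and t: "t \<in> carrier ?T"
    show "ract ?T t (a \<oplus>\<^bsub>A\<^esub> b) = ract ?T t a \<oplus>\<^bsub>?T\<^esub> ract ?T t b"
      by (rule ext[OF _ additive_map_sum[OF T.abelian_group_axioms] _ t])
        (use ab in \<open>simp_all add: add ract_pure_tensor M N N.ract_add_scalar p.add_right N.ract_closed\<close>)
    show "ract ?T t (a \<otimes>\<^bsub>A\<^esub> b) = ract ?T (ract ?T t a) b"
      by (rule ext[OF _ additive_map_comp[of ?T ?T "\<lambda>t. ract ?T t a" ?T "\<lambda>t. ract ?T t b"] _ t])
        (use ab in \<open>simp_all add: add ract_pure_tensor M N N.ract_mult N.ract_closed\<close>)
  next
    fix t assume t: "t \<in> carrier ?T"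
    show "ract ?T t \<one>\<^bsub>A\<^esub> = t"
      by (rule ext[OF _ additive_map_id(2) _ t])
        (simp_all add: add ract_pure_tensor M N N.ract_one)
  qed
qed

section \<open>The associativity constraint\<close>

locale tensor_triple =
  fixes A :: "('a, 'j) ring_scheme" and M :: "('a, 'm, 'k) bimod_scheme"
    and N :: "('a, 'n, 'l) bimod_scheme" and P :: "('a, 'p, 'i) bimod_scheme"
  assumes M: "right_module A M" and N: "bimodule A N" and P: "left_module A P"
begin

abbreviation "NP \<equiv> tensor A N P"
abbreviation "MN \<equiv> tensor A M N"
abbreviation "T \<equiv> tensor A M NP"

lemma N': "right_module A N" "left_module A N"
  using N by (simp_all add: bimodule.axioms)

lemma MN: "right_module A MN"
  using M N by (rule right_module_tensor)

lemma NP: "left_module A NP"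
  using N P by (rule left_module_tensor)

lemma T: "abelian_group T"
  using M NP by (rule abelian_group_tensor)

lemma inner_balanced:
  assumes z: "z \<in> carrier P"
  shows "balanced_map A M N T (\<lambda>x y. pure_tensor A M NP x (pure_tensor A N P y z))"
proof -
  interpret N: bimodule A N by (rule N)
  interpret P: left_module A P by (rule P)
  interpret p: balanced_map A N P NP "pure_tensor A N P"
    by (rule pure_tensor_balanced[OF N'(1) P])
  interpret q: balanced_map A M NP T "pure_tensor A M NP"
    by (rule pure_tensor_balanced[OF M NP])
  show ?thesis
    by (rule balanced_map.intro)
      (use z in \<open>simp_all add: M N' T p.closed q.closed p.add_left q.add_left q.add_right q.balanced
        lact_pure_tensor[OF N P]\<close>)
qed

text \<open>\<open>tensor_assoc\<close> is a lift of a lift, so well-definedness is shown twice. The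
  laws in z compare values of inner lifts for different z; for fixed z these are additive maps in t
  and can be compared on pure tensors by \<open>inner_balanced\<close>.\<close>

lemma outer_balanced:
  "balanced_map A MN P T
    (\<lambda>t z. tensor_lift T (\<lambda>x y. pure_tensor A M NP x (pure_tensor A N P y z)) t)"
    (is "balanced_map A MN P T (\<lambda>t z. ?l z t)")
proof (rule balanced_map.intro[OF MN P T])
  interpret N: bimodule A N by (rule N)
  interpret P: left_module A P by (rule P)
  interpret p: balanced_map A N P NP "pure_tensor A N P"
    by (rule pure_tensor_balanced[OF N'(1) P])
  interpret q: balanced_map A M NP T "pure_tensor A M NP"
    by (rule pure_tensor_balanced[OF M NP])
  note inner = inner_balanced
  note lift = balanced_map.tensor_lift_additive[OF inner]
  note pure = balanced_map.tensor_lift_pure[OF inner]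
  fix t assume t: "t \<in> carrier MN"
  fix z assume z: "z \<in> carrier P"
  show "?l z t \<in> carrier T" using lift[OF z] t by (rule additive_map_closed)
  show "?l z (t \<oplus>\<^bsub>MN\<^esub> t') = ?l z t \<oplus>\<^bsub>T\<^esub> ?l z t'" if "t' \<in> carrier MN" for t'
    using lift[OF z] t that by (rule additive_map_add)
  show "?l (z \<oplus>\<^bsub>P\<^esub> z') t = ?l z t \<oplus>\<^bsub>T\<^esub> ?l z' t" if z': "z' \<in> carrier P" for z'
    by (rule tensor_ext[OF M N'(2) T _ additive_map_sum[OF T] _ t])
      (use z z' in \<open>simp_all add: lift pure p.add_right q.add_right p.closed\<close>)
  show "?l z (ract MN t a) = ?l (lact P a z) t" if a: "a \<in> carrier A" for a
    by (rule tensor_ext[OF M N'(2) T additive_map_comp[OF ract_tensor_additive[OF M N a] lift] _ _ t])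
      (use z a in \<open>simp_all add: lift pure p.balanced ract_pure_tensor[OF M N] P.lact_closed N.ract_closed\<close>)
qed

lemma tensor_assoc_additive: "additive_map (tensor A MN P) T (tensor_assoc A M N P)"
  using balanced_map.tensor_lift_additive[OF outer_balanced]
  by (simp add: tensor_assoc_def Let_def)

lemma tensor_assoc_pure:
  assumes "t \<in> carrier MN" "z \<in> carrier P"
  shows "tensor_assoc A M N P (pure_tensor A MN P t z) =
    tensor_lift T (\<lambda>x y. pure_tensor A M NP x (pure_tensor A N P y z)) t"
  using balanced_map.tensor_lift_pure[OF outer_balanced assms]
  by (simp add: tensor_assoc_def Let_def)

lemma tensor_assoc_pure_pure:
  assumes "x \<in> carrier M" "y \<in> carrier N" "z \<in> carrier P"
  shows "tensor_assoc A M N P (pure_tensor A MN P (pure_tensor A M N x y) z) =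
    pure_tensor A M NP x (pure_tensor A N P y z)"
  using assms
  by (simp add: tensor_assoc_pure pure_tensor_closed M N' balanced_map.tensor_lift_pure[OF inner_balanced])

lemma pure_tensor_additive_left:
  assumes "z \<in> carrier P"
  shows "additive_map MN (tensor A MN P) (\<lambda>t. pure_tensor A MN P t z)"
  using pure_tensor_balanced[OF MN P] assms
  by (intro additive_mapI) (simp_all add: balanced_map.closed balanced_map.add_left)

end

section \<open>The dual ring of a coring\<close>

lemma regular_bimod_simps [simp]:
  "carrier (regular_bimod A) = carrier A" "add (regular_bimod A) = add A"
  "lact (regular_bimod A) = monoid.mult A" "ract (regular_bimod A) = monoid.mult A"
  by (simp_all add: regular_bimod_def)

lemma dual_ring_simps:
  "carrier (dual_ring A C) = right_Hom A C (regular_bimod A)"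
  "f \<otimes>\<^bsub>dual_ring A C\<^esub> g = (\<lambda>c\<in>carrier C. g (harpoon C c f))"
  "\<one>\<^bsub>dual_ring A C\<^esub> = (\<lambda>c\<in>carrier C. counit C c)"
  "\<zero>\<^bsub>dual_ring A C\<^esub> = (\<lambda>c\<in>carrier C. \<zero>\<^bsub>A\<^esub>)"
  "f \<oplus>\<^bsub>dual_ring A C\<^esub> g = (\<lambda>c\<in>carrier C. f c \<oplus>\<^bsub>A\<^esub> g c)"
  by (simp_all add: dual_ring_def)

text \<open>Elements of the dual ring are \<open>undefined\<close> off the carrier, while formulas
  such as c \<mapsto> g(c f) are not. This passes between a function and its restriction; closure of
  the module operations keeps all arguments inside the carrier.\<close>

lemma right_linear_cong:
  assumes "right_module A M" "\<And>x. x \<in> carrier M \<Longrightarrow> h x = k x"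
  shows "right_linear A M N h \<longleftrightarrow> right_linear A M N k"
proof -
  interpret right_module A M by fact
  show ?thesis
    by (simp add: right_linear_def additive_map_def Pi_def assms(2) ract_closed)
qed

context coring
begin

abbreviation "dual \<equiv> right_linear A C (regular_bimod A)"
abbreviation "CC \<equiv> tensor A C C"
abbreviation "D \<equiv> dual_ring A C"

lemma dual_closed: "\<lbrakk>dual f; x \<in> carrier C\<rbrakk> \<Longrightarrow> f x \<in> carrier A"
  and dual_add: "\<lbrakk>dual f; x \<in> carrier C; y \<in> carrier C\<rbrakk> \<Longrightarrow> f (x \<oplus>\<^bsub>C\<^esub> y) = f x \<oplus>\<^bsub>A\<^esub> f y"
  and dual_ract: "\<lbrakk>dual f; x \<in> carrier C; a \<in> carrier A\<rbrakk> \<Longrightarrow> f (ract C x a) = f x \<otimes>\<^bsub>A\<^esub> a"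
  using right_linear_closed[of A C "regular_bimod A" f x] right_linear_add[of A C "regular_bimod A" f x y]
    right_linear_ract[of A C "regular_bimod A" f x a]
  by auto

lemmas C_right = C.right_module_axioms and C_left = C.left_module_axioms and C_bimod = C.bimodule_axioms
  and C_group = C.M.abelian_group_axioms

lemma comult_closed: "c \<in> carrier C \<Longrightarrow> comult C c \<in> carrier CC"
  using right_linear_closed[OF comult_right_linear] .

section \<open>The action of functionals on the coring\<close>

text \<open>Contraction of the left factor by f. The module \<open>X\<close> is arbitrary because
  both \<open>X\<close> = C, which gives the action, and \<open>X\<close> = C \<otimes> C, to which
  coassociativity is contracted, are needed.\<close>

lemma contract_balanced:
  assumes X: "left_module A X" and f: "dual f"
  shows "balanced_map A C X X (\<lambda>x t. lact X (f x) t)"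
proof -
  interpret X: left_module A X by fact
  show ?thesis
    by (rule balanced_map.intro)
      (simp_all add: C_right X X.abelian_group_axioms dual_closed[OF f] dual_add[OF f] dual_ract[OF f]
        X.lact_closed X.lact_add_scalar X.lact_add X.lact_mult)
qed

lemmas contract_additive = balanced_map.tensor_lift_additive[OF contract_balanced]
  and contract_pure = balanced_map.tensor_lift_pure[OF contract_balanced]

text \<open>A acts on the right of C \<otimes> C through the second factor, which the contraction by
  f leaves in place; the bimodule law of C then moves the scalar f(x) past the right action.\<close>

lemma harpoon_right_linear:
  assumes f: "dual f"
  shows "right_linear A C C (\<lambda>c. harpoon C c f)"
  unfolding harpoon_def
proof (rule right_linearI)
  show "additive_map C C (\<lambda>c. tensor_lift C (\<lambda>x t. lact C (f x) t) (comult C c))"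
    by (rule additive_map_comp[OF right_linear_additive[OF comult_right_linear] contract_additive[OF C_left f]])
  fix c a assume c: "c \<in> carrier C" and a: "a \<in> carrier A"
  have "tensor_lift C (\<lambda>x t. lact C (f x) t) (ract CC t a) = ract C (tensor_lift C (\<lambda>x t. lact C (f x) t) t) a"
    if "t \<in> carrier CC" for t
    by (rule tensor_ext[OF C_right C_left C_group
          additive_map_comp[OF ract_tensor_additive[OF C_right C_bimod a] contract_additive[OF C_left f]]
          additive_map_comp[OF contract_additive[OF C_left f] left_linear_additive[OF C.left_linear_ract[OF a]]] _ that])
      (simp add: ract_pure_tensor[OF C_right C_bimod a] contract_pure[OF C_left f] C.ract_closed a C.lact_ract dual_closed[OF f])
  then show "tensor_lift C (\<lambda>x t. lact C (f x) t) (comult C (ract C c a)) =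
      ract C (tensor_lift C (\<lambda>x t. lact C (f x) t) (comult C c)) a"
    using c a by (simp add: right_linear_ract[OF comult_right_linear] comult_closed)
qed

lemmas harpoon_closed = right_linear_closed[OF harpoon_right_linear]
  and harpoon_add = right_linear_add[OF harpoon_right_linear]

lemma comult_harpoon:
  assumes f: "dual f" and c: "c \<in> carrier C"
  shows "comult C (harpoon C c f) = tensor_map A C C (\<lambda>c. harpoon C c f) id (comult C c)"
proof -
  interpret ttt: tensor_triple A C C C
    by (rule tensor_triple.intro[OF C_right C_bimod C_left])
  have LT: "left_module A CC" by (rule left_module_tensor[OF C_bimod C_left])
  have RT: "right_module A CC" by (rule right_module_tensor[OF C_right C_bimod])
  have AT: "abelian_group CC" by (rule abelian_group_tensor[OF C_right C_left])
  interpret l: tensor_linear A C C CC C "comult C" id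
    by (rule tensor_linear.intro[OF C_right C_left RT C_left comult_right_linear left_linear_id])
  interpret r: tensor_linear A C C C CC id "comult C"
    by (rule tensor_linear.intro[OF C_right C_left C_right LT right_linear_id comult_left_linear])
  interpret h: tensor_linear A C C C C "\<lambda>c. harpoon C c f" id
    by (rule tensor_linear.intro[OF C_right C_left C_right C_left harpoon_right_linear[OF f] left_linear_id])
  let ?psi = "tensor_lift CC (\<lambda>x t. lact CC (f x) t)"
  let ?con = "tensor_lift C (\<lambda>x t. lact C (f x) t)"
  note psi = contract_additive[OF LT f] and con = contract_additive[OF C_left f]
  \<comment> \<open>On x \<otimes> y this says f(x) \<Delta>(y) = \<Delta>(f(x) y), which is left
    linearity of \<Delta>.\<close>
  have 1: "?psi (tensor_map A C CC id (comult C) s) = comult C (?con s)" if "s \<in> carrier CC" for s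
    by (rule tensor_ext[OF C_right C_left AT additive_map_comp[OF r.tensor_map_additive psi]
          additive_map_comp[OF con left_linear_additive[OF comult_left_linear]] _ that])
      (simp add: r.tensor_map_pure contract_pure[OF LT f] contract_pure[OF C_left f] comult_closed
        left_linear_lact[OF comult_left_linear] dual_closed[OF f])
  \<comment> \<open>Contracting after reassociation only touches the two inner factors: for t = a
    \<otimes> b both sides are (f(a) b) \<otimes> y.\<close>
  have 2: "?psi (tensor_assoc A C C C (pure_tensor A CC C t y)) = pure_tensor A C C (?con t) y"
    if t: "t \<in> carrier CC" and y: "y \<in> carrier C" for t y
    by (rule tensor_ext[OF C_right C_left AT
          additive_map_comp[OF ttt.pure_tensor_additive_left[OF y]
            additive_map_comp[OF ttt.tensor_assoc_additive psi]] _ _ t])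
      (use y in \<open>simp_all add: ttt.tensor_assoc_pure_pure contract_pure[OF LT f] contract_pure[OF C_left f]
        pure_tensor_closed C_right C_left lact_pure_tensor[OF C_bimod C_left] dual_closed[OF f]
        additive_map_comp[OF con, of CC "\<lambda>x. pure_tensor A C C x y"]
        balanced_map.add_left[OF pure_tensor_balanced] additive_mapI\<close>)
  have 3: "?psi (tensor_assoc A C C C (tensor_map A CC C (comult C) id s)) =
      tensor_map A C C (\<lambda>c. harpoon C c f) id s" if "s \<in> carrier CC" for s
    by (rule tensor_ext[OF C_right C_left AT
          additive_map_comp[OF l.tensor_map_additive additive_map_comp[OF ttt.tensor_assoc_additive psi]]
          h.tensor_map_additive _ that])
      (simp add: l.tensor_map_pure h.tensor_map_pure 2 comult_closed flip: harpoon_def)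
  show ?thesis
    using 1[OF comult_closed[OF c]] 3[OF comult_closed[OF c]] coassociative[OF c]
    by (simp add: harpoon_def)
qed

lemma harpoon_cong:
  assumes "dual f" "dual g" "c \<in> carrier C" "\<And>x. x \<in> carrier C \<Longrightarrow> f x = g x"
  shows "harpoon C c f = harpoon C c g"
  unfolding harpoon_def
  by (rule tensor_ext[OF C_right C_left C_group contract_additive[OF C_left assms(1)] contract_additive[OF C_left assms(2)] _
        comult_closed[OF assms(3)]])
    (simp add: contract_pure[OF C_left assms(1)] contract_pure[OF C_left assms(2)] assms(4))

lemma dual_harpoon: "\<lbrakk>dual f; dual g\<rbrakk> \<Longrightarrow> dual (\<lambda>c. g (harpoon C c f))"
  by (rule right_linear_comp[OF harpoon_right_linear])

lemma dual_restrict: "dual (restrict f (carrier C)) \<longleftrightarrow> dual f"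
  by (rule right_linear_cong[OF C_right]) simp

text \<open>By colinearity \<Delta>(h(c)) arises from \<Delta>(c) by applying h to the left factor,
  and contracting by g afterwards is contracting by g \<circ> h. The case g = \<epsilon> represents
  h as the action of a functional; the case where h is the action of f gives the law (c f) g = c (f
  g).\<close>

lemma harpoon_colinear:
  assumes h: "right_linear A C C h" and g: "dual g" and c: "c \<in> carrier C"
    and comult: "comult C (h c) = tensor_map A C C h id (comult C c)"
  shows "harpoon C (h c) g = harpoon C c (\<lambda>c. g (h c))"
proof -
  interpret h: tensor_linear A C C C C h id
    by (rule tensor_linear.intro[OF C_right C_left C_right C_left h left_linear_id])
  have gh: "dual (\<lambda>c. g (h c))" by (rule right_linear_comp[OF h g])
  show ?thesis
    unfolding harpoon_def comult
    by (rule tensor_ext[OF C_right C_left C_group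
          additive_map_comp[OF h.tensor_map_additive contract_additive[OF C_left g]]
          contract_additive[OF C_left gh] _ comult_closed[OF c]])
      (simp add: h.tensor_map_pure contract_pure[OF C_left g] contract_pure[OF C_left gh] right_linear_closed[OF h])
qed

lemma harpoon_harpoon:
  assumes "dual f" "dual g" "c \<in> carrier C"
  shows "harpoon C (harpoon C c f) g = harpoon C c (f \<otimes>\<^bsub>D\<^esub> g)"
  using assms
  by (simp add: harpoon_colinear[OF harpoon_right_linear] comult_harpoon dual_ring_simps
      harpoon_cong[of "\<lambda>c. g (harpoon C c f)"] dual_harpoon dual_restrict)

lemma dual_counit: "dual (counit C)"
  by (rule counit_right_linear)

lemma harpoon_counit: "c \<in> carrier C \<Longrightarrow> harpoon C c (counit C) = c"
  unfolding harpoon_def by (rule counit_left)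

text \<open>In Sweedler notation, with left linearity of \<epsilon>, right linearity of f and the
  right counit law: \<epsilon>(f(c1) c2) = f(c1) \<epsilon>(c2) = f(c1 \<epsilon>(c2)) = f(c). A
  functional is thus recovered from its action, which makes the action faithful.\<close>

lemma counit_harpoon:
  assumes f: "dual f" and c: "c \<in> carrier C"
  shows "counit C (harpoon C c f) = f c"
proof -
  interpret r: balanced_map A C C C "\<lambda>x y. ract C x (counit C y)"
    by (rule balanced_map.intro)
      (simp_all add: C_right C_left C_group C.ract_closed C.ract_add C.ract_add_scalar C.ract_mult
        left_linear_closed[OF counit_left_linear, simplified]
        left_linear_add[OF counit_left_linear, simplified]
        left_linear_lact[OF counit_left_linear, simplified])
  note e = left_linear_closed[OF counit_left_linear, simplified]
  have fa: "additive_map C A f" "additive_map C A (counit C)"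
    using right_linear_additive[OF f] right_linear_additive[OF counit_right_linear]
    by (simp_all add: additive_map_def)
  have "counit C (tensor_lift C (\<lambda>x t. lact C (f x) t) t) = f (tensor_lift C (\<lambda>x y. ract C x (counit C y)) t)"
    if "t \<in> carrier CC" for t
    by (rule tensor_ext[OF C_right C_left C.A.abelian_group_axioms
          additive_map_comp[OF contract_additive[OF C_left f] fa(2)]
          additive_map_comp[OF r.tensor_lift_additive fa(1)] _ that])
      (simp add: contract_pure[OF C_left f] r.tensor_lift_pure dual_ract[OF f] e dual_closed[OF f]
        left_linear_lact[OF counit_left_linear, simplified])
  then show ?thesis
    using c counit_right[OF c] by (simp add: harpoon_def comult_closed)
qed

section \<open>The ring structure on the functionals\<close>

lemma dual_ring_carrier: "f \<in> carrier D \<longleftrightarrow> f \<in> extensional (carrier C) \<and> dual f"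
  by (simp add: dual_ring_simps right_Hom_def)

lemma dual_ringD: "f \<in> carrier D \<Longrightarrow> dual f"
  by (simp add: dual_ring_carrier)

lemma dual_ring_eqI:
  assumes "f \<in> carrier D" "g \<in> carrier D" "\<And>c. c \<in> carrier C \<Longrightarrow> f c = g c"
  shows "f = g"
  using assms by (auto simp: dual_ring_carrier intro: extensionalityI)

lemma harpoon_plus:
  assumes f: "dual f" and g: "dual g" and fg: "dual (\<lambda>x. f x \<oplus>\<^bsub>A\<^esub> g x)" and c: "c \<in> carrier C"
  shows "harpoon C c (\<lambda>x. f x \<oplus>\<^bsub>A\<^esub> g x) = harpoon C c f \<oplus>\<^bsub>C\<^esub> harpoon C c g"
  unfolding harpoon_def
  by (rule tensor_ext[OF C_right C_left C_group contract_additive[OF C_left fg]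
        additive_map_sum[OF C_group contract_additive[OF C_left f] contract_additive[OF C_left g]] _ comult_closed[OF c]])
    (simp add: contract_pure[OF C_left f] contract_pure[OF C_left g] contract_pure[OF C_left fg]
      C.lact_add_scalar dual_closed[OF f] dual_closed[OF g])

lemma dual_plus:
  assumes f: "dual f" and g: "dual g"
  shows "dual (\<lambda>x. f x \<oplus>\<^bsub>A\<^esub> g x)"
  by (rule right_linearI, rule additive_mapI)
    (simp_all add: dual_closed[OF f] dual_closed[OF g] dual_add[OF f] dual_add[OF g] C.A.a_ac
      dual_ract[OF f] dual_ract[OF g] C.A.l_distr)

lemma dual_uminus:
  assumes f: "dual f"
  shows "dual (\<lambda>x. \<ominus>\<^bsub>A\<^esub> f x)"
  by (rule right_linearI, rule additive_mapI)
    (simp_all add: dual_closed[OF f] dual_add[OF f] C.A.minus_add C.A.a_comm dual_ract[OF f] C.A.l_minus)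

lemma dual_zero: "dual (\<lambda>x. \<zero>\<^bsub>A\<^esub>)"
  by (rule right_linearI, rule additive_mapI) simp_all

lemma dual_ring_mult_closed: "\<lbrakk>f \<in> carrier D; g \<in> carrier D\<rbrakk> \<Longrightarrow> f \<otimes>\<^bsub>D\<^esub> g \<in> carrier D"
  by (simp add: dual_ring_carrier dual_ring_simps(2) dual_restrict dual_harpoon)

lemma dual_ring_one_closed: "\<one>\<^bsub>D\<^esub> \<in> carrier D"
  by (simp add: dual_ring_carrier dual_ring_simps(3) dual_restrict dual_counit)

lemma dual_ring_apply:
  assumes "c \<in> carrier C"
  shows "(f \<otimes>\<^bsub>D\<^esub> g) c = g (harpoon C c f)" "\<one>\<^bsub>D\<^esub> c = counit C c" "\<zero>\<^bsub>D\<^esub> c = \<zero>\<^bsub>A\<^esub>"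
    "(f \<oplus>\<^bsub>D\<^esub> g) c = f c \<oplus>\<^bsub>A\<^esub> g c"
  using assms by (simp_all add: dual_ring_simps)

lemma harpoon_one: "c \<in> carrier C \<Longrightarrow> harpoon C c \<one>\<^bsub>D\<^esub> = c"
  using harpoon_cong[of "\<one>\<^bsub>D\<^esub>" "counit C" c]
  by (simp add: dual_ring_simps(3) dual_restrict dual_counit harpoon_counit)

lemma harpoon_dual_ring_add:
  assumes f: "f \<in> carrier D" and g: "g \<in> carrier D" and c: "c \<in> carrier C"
  shows "harpoon C c (f \<oplus>\<^bsub>D\<^esub> g) = harpoon C c f \<oplus>\<^bsub>C\<^esub> harpoon C c g"
  using harpoon_plus[OF dual_ringD[OF f] dual_ringD[OF g] _ c]
    harpoon_cong[of "f \<oplus>\<^bsub>D\<^esub> g" "\<lambda>x. f x \<oplus>\<^bsub>A\<^esub> g x" c] c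
  by (simp add: dual_ring_simps(5) dual_restrict dual_plus dual_ringD[OF f] dual_ringD[OF g])

text \<open>As the product f g takes c to g(c f), the ring laws follow from laws of the action:
  associativity from \<open>harpoon_harpoon\<close>, the two unit laws from
  \<open>harpoon_one\<close> and \<open>counit_harpoon\<close>, distributivity in the first factor
  from additivity of c f in f. In the second factor distributivity is pointwise.\<close>

lemma ring_dual_ring: "ring D"
proof (intro ringI abelian_groupI monoidI)
  fix f assume f: "f \<in> carrier D"
  then show "\<zero>\<^bsub>D\<^esub> \<oplus>\<^bsub>D\<^esub> f = f"
    by (auto simp: dual_ring_simps(4,5) dual_ring_carrier dual_closed extensional_def)
  show "\<exists>g\<in>carrier D. g \<oplus>\<^bsub>D\<^esub> f = \<zero>\<^bsub>D\<^esub>"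
    using f by (intro bexI[of _ "\<lambda>c\<in>carrier C. \<ominus>\<^bsub>A\<^esub> f c"])
      (auto simp: dual_ring_simps(4,5) dual_ring_carrier dual_closed dual_restrict dual_uminus C.A.l_neg)
  show "\<one>\<^bsub>D\<^esub> \<otimes>\<^bsub>D\<^esub> f = f" "f \<otimes>\<^bsub>D\<^esub> \<one>\<^bsub>D\<^esub> = f"
    by (rule dual_ring_eqI; simp add: f dual_ring_mult_closed dual_ring_one_closed dual_ring_apply
        harpoon_one counit_harpoon dual_ringD harpoon_closed)+
  fix g assume g: "g \<in> carrier D"
  show fg: "f \<oplus>\<^bsub>D\<^esub> g \<in> carrier D"
    using f g by (simp add: dual_ring_carrier dual_ring_simps(5) dual_restrict dual_plus)
  show "f \<oplus>\<^bsub>D\<^esub> g = g \<oplus>\<^bsub>D\<^esub> f"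
    using f g by (auto simp: dual_ring_simps(5) dual_ring_carrier dual_closed C.A.a_comm)
  show "f \<otimes>\<^bsub>D\<^esub> g \<in> carrier D"
    using f g by (rule dual_ring_mult_closed)
  fix h assume h: "h \<in> carrier D"
  have plus: "\<lbrakk>u \<in> carrier D; v \<in> carrier D\<rbrakk> \<Longrightarrow> u \<oplus>\<^bsub>D\<^esub> v \<in> carrier D" for u v
    by (simp add: dual_ring_carrier dual_ring_simps(5) dual_restrict dual_plus)
  show "f \<oplus>\<^bsub>D\<^esub> g \<oplus>\<^bsub>D\<^esub> h = f \<oplus>\<^bsub>D\<^esub> (g \<oplus>\<^bsub>D\<^esub> h)"
    using f g h by (auto simp: dual_ring_simps(5) dual_ring_carrier dual_closed C.A.a_assoc)
  show "f \<otimes>\<^bsub>D\<^esub> g \<otimes>\<^bsub>D\<^esub> h = f \<otimes>\<^bsub>D\<^esub> (g \<otimes>\<^bsub>D\<^esub> h)"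
    by (rule dual_ring_eqI; simp add: f g h dual_ring_mult_closed dual_ring_apply dual_ringD
        harpoon_closed flip: harpoon_harpoon)
  show "(f \<oplus>\<^bsub>D\<^esub> g) \<otimes>\<^bsub>D\<^esub> h = f \<otimes>\<^bsub>D\<^esub> h \<oplus>\<^bsub>D\<^esub> g \<otimes>\<^bsub>D\<^esub> h"
    by (rule dual_ring_eqI; simp add: f g h plus dual_ring_mult_closed dual_ring_apply dual_ringD
        harpoon_closed harpoon_dual_ring_add dual_add)
  show "h \<otimes>\<^bsub>D\<^esub> (f \<oplus>\<^bsub>D\<^esub> g) = h \<otimes>\<^bsub>D\<^esub> f \<oplus>\<^bsub>D\<^esub> h \<otimes>\<^bsub>D\<^esub> g"
    by (rule dual_ring_eqI; simp add: f g h plus dual_ring_mult_closed dual_ring_apply dual_ringD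
        harpoon_closed)
qed (simp add: dual_ring_carrier dual_ring_simps(4) dual_restrict dual_zero, rule dual_ring_one_closed)

end

section \<open>Flatness, subcomodules and factor comodules\<close>

text \<open>\<open>N\<close> is described field by field so that the result applies to records in
  which the coaction has been replaced together with the carrier.\<close>

lemma (in right_module) right_module_submodule:
  assumes sub: "subgroup K (add_monoid M)" and ract: "\<And>x a. \<lbrakk>x \<in> K; a \<in> carrier A\<rbrakk> \<Longrightarrow> ract M x a \<in> K"
    and N: "carrier N = K" "add N = add M" "zero N = zero M" "bimod.ract N = bimod.ract M"
  shows "right_module A N"
proof -
  have inM: "x \<in> K \<Longrightarrow> x \<in> carrier M" for x using subgroup.mem_carrier[OF sub] by simp
  have "abelian_group N"
  proof (rule abelian_groupI)
    fix x assume "x \<in> carrier N"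
    then show "\<exists>y\<in>carrier N. y \<oplus>\<^bsub>N\<^esub> x = \<zero>\<^bsub>N\<^esub>"
      using subgroup.m_inv_closed[OF sub, of x] inM[of x]
      by (intro bexI[of _ "\<ominus>\<^bsub>M\<^esub> x"]) (auto simp: N a_inv_def[symmetric] M.l_neg)
  qed (use subgroup.m_closed[OF sub] subgroup.one_closed[OF sub] inM in
      \<open>auto simp: N M.a_assoc intro: M.a_comm\<close>)
  then show ?thesis
    by (intro right_module.intro right_module_axioms.intro A.ring_axioms)
      (auto simp: N ract inM ract_add_scalar ract_add ract_mult ract_one)
qed

text \<open>The module laws pass along any surjection compatible with the operations. The map p will
  be an injective renaming of elements, the projection to a factor module, or the identity between
  records of different type.\<close>

lemma right_module_image:
  assumes M: "right_module A M" and carrier: "carrier N = p ` carrier M" and zero: "\<zero>\<^bsub>N\<^esub> = p \<zero>\<^bsub>M\<^esub>"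
    and add: "\<And>x y. \<lbrakk>x \<in> carrier M; y \<in> carrier M\<rbrakk> \<Longrightarrow> p x \<oplus>\<^bsub>N\<^esub> p y = p (x \<oplus>\<^bsub>M\<^esub> y)"
    and ract: "\<And>x a. \<lbrakk>x \<in> carrier M; a \<in> carrier A\<rbrakk> \<Longrightarrow> ract N (p x) a = p (ract M x a)"
  shows "right_module A N" "right_linear A M N p"
proof -
  interpret M: right_module A M by fact
  have "abelian_group N"
  proof (rule abelian_groupI)
    fix x assume "x \<in> carrier N"
    then obtain x' where x': "x' \<in> carrier M" "x = p x'" by (auto simp: carrier)
    then show "\<exists>y\<in>carrier N. y \<oplus>\<^bsub>N\<^esub> x = \<zero>\<^bsub>N\<^esub>"
      by (intro bexI[of _ "p (\<ominus>\<^bsub>M\<^esub> x')"]) (auto simp: carrier zero add M.M.l_neg)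
  qed (auto simp: carrier zero add M.M.a_ac)
  then show "right_module A N"
    by (intro right_module.intro right_module_axioms.intro M.ring_axioms)
      (auto simp: carrier add ract M.ract_closed M.ract_add_scalar M.ract_add M.ract_mult M.ract_one)
  show "right_linear A M N p"
    by (intro right_linearI additive_mapI) (auto simp: carrier add ract)
qed

text \<open>The test modules of \<^const>\<open>flat_left_module\<close> have carriers in a fixed type; a module with carrier in
  the type of \<open>N\<close> is first copied into it.\<close>

lemma flat_tensor_map_inj:
  fixes A :: "('a, 'j) ring_scheme" and N :: "('a, 'n, 'l) bimod_scheme"
    and K :: "('a, 'n, 'k) bimod_scheme" and M :: "('a, 'n, 'm) bimod_scheme"
  assumes flat: "flat_left_module A N" and K: "right_module A K" and M: "right_module A M"
    and h: "right_linear A K M h" and inj: "inj_on h (carrier K)"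
  shows "inj_on (tensor_map A M N h id) (carrier (tensor A K N))"
proof (rule inj_onI)
  have N: "left_module A N" using flat by (simp add: flat_left_module_def)
  \<comment> \<open>An injection of the elements of K and M into the type of the test modules: x
    goes to the singleton of a basis element that mentions x.\<close>
  define e :: "'n \<Rightarrow> ('a + 'n, 'n) tens" where "e x = {frag_of (Inr x, x)}" for x
  define e' where "e' = inv_into UNIV e"
  have e'e [simp]: "e' (e x) = x" for x
    unfolding e'_def by (rule inv_f_f) (auto simp: inj_def e_def frag_of_eq)
  then have e_eq: "e x = e y \<longleftrightarrow> x = y" for x y by metis
  \<comment> \<open>Transport of structure: the operations of \<open>Y\<close> decode with
    \<open>e'\<close>, compute in \<open>X\<close> and encode with \<open>e\<close>, so
    \<open>e\<close> and \<open>e'\<close> are mutually inverse linear maps.\<close>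
  have copy: "right_module A Y \<and> right_linear A X Y e \<and> right_linear A Y X e'"
    if X: "right_module A X" and Y: "Y =
    \<lparr>carrier = e ` carrier X, monoid.mult = undefined, one = undefined, zero = e \<zero>\<^bsub>X\<^esub>,
      add = (\<lambda>x y. e (e' x \<oplus>\<^bsub>X\<^esub> e' y)), lact = undefined,
      ract = (\<lambda>x a. e (ract X (e' x) a))\<rparr>"
    for X :: "('a, 'n, 'o) bimod_scheme" and Y
    using right_module_image[OF X, of Y e]
    by (auto simp: Y right_linear_def additive_map_def)
  obtain K' :: "('a, ('a + 'n, 'n) tens) bimod" where K': "right_module A K'"
      "right_linear A K K' e" "right_linear A K' K e'" "carrier K' = e ` carrier K"
    using copy[OF K refl] by fastforce
  obtain M' :: "('a, ('a + 'n, 'n) tens) bimod" where M': "right_module A M'"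
      "right_linear A M M' e" "right_linear A M' M e'" "carrier M' = e ` carrier M"
    using copy[OF M refl] by fastforce
  have h': "right_linear A K' M' (\<lambda>x. e (h (e' x)))"
    by (rule right_linear_comp[OF right_linear_comp[OF K'(3) h] M'(2)])
  moreover have "inj_on (\<lambda>x. e (h (e' x))) (carrier K')"
    using inj by (auto simp: inj_on_def K'(4) e_eq)
  ultimately have inj': "inj_on (tensor_map A M' N (\<lambda>x. e (h (e' x))) id) (carrier (tensor A K' N))"
    using flat K'(1) M'(1) unfolding flat_left_module_def by blast
  have tl: "tensor_linear A X N Y N f id"
    if "right_module A X" "right_module A Y" "right_linear A X Y f"
    for X :: "('a, 'u, 'x) bimod_scheme" and Y :: "('a, 'v, 'y) bimod_scheme" and f
    using that N by (simp add: tensor_linear_def)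
  note i = tl[OF K K'(1,2)] and i' = tl[OF K'(1) K K'(3)] and j = tl[OF M M'(1,2)]
    and H = tl[OF K M h] and H' = tl[OF K'(1) M'(1) h']
  fix s t assume s: "s \<in> carrier (tensor A K N)" and t: "t \<in> carrier (tensor A K N)"
    and eq: "tensor_map A M N h id s = tensor_map A M N h id t"
  \<comment> \<open>Renaming commutes with h, so tensoring gives a commutative square whose lower
    edge is injective by flatness.\<close>
  have "tensor_map A M' N (\<lambda>x. e (h (e' x))) id (tensor_map A K' N e id u) =
      tensor_map A M' N e id (tensor_map A M N h id u)" if u: "u \<in> carrier (tensor A K N)" for u
    using tensor_map_comp[OF i H' u] tensor_map_comp[OF H j u] by simp
  then have "tensor_map A K' N e id s = tensor_map A K' N e id t"
    using inj_onD[OF inj' _ tensor_linear.tensor_map_closed[OF i s] tensor_linear.tensor_map_closed[OF i t]]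
      s t eq by simp
  \<comment> \<open>Renaming is injective on tensors by functoriality: its left inverse
    \<open>e'\<close> also induces a map of tensor products.\<close>
  moreover have "tensor_map A K N e' id (tensor_map A K' N e id u) = u"
    if u: "u \<in> carrier (tensor A K N)" for u
    using tensor_map_comp[OF i i' u] tensor_map_id[OF K N u] by (simp add: id_def)
  ultimately show "s = t" using s t by metis
qed

text \<open>Tensor constructions read only the carrier, addition and actions of the left factor.
  Hence C and \<open>coring_comod C\<close> have equal tensor products, as do copies of one module
  with different coactions.\<close>

lemma tensor_left_cong:
  assumes "carrier M = carrier M'" "add M = add M'" "ract M = ract M'" "lact M = lact M'"
  shows "tensor A M N = tensor A M' N" "pure_tensor A M N = pure_tensor A M' N"
    "tensor_map A M N = tensor_map A M' N"
proof -
  have rel: "tensor_rel A M N = tensor_rel A M' N"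
    unfolding tensor_rel_def by (simp add: assms)
  have group: "tensor_group A M N = tensor_group A M' N"
    unfolding tensor_group_def by (simp add: assms rel)
  show pure: "pure_tensor A M N = pure_tensor A M' N"
    unfolding pure_tensor_def[abs_def] by (simp add: assms rel)
  show map: "tensor_map A M N = tensor_map A M' N"
    unfolding tensor_map_def[abs_def] by (simp add: pure group)
  show "tensor A M N = tensor A M' N"
    unfolding tensor_def by (simp add: group map assms)
qed

lemma coring_comod_simps [simp]:
  "carrier (coring_comod C) = carrier C" "add (coring_comod C) = add C"
  "zero (coring_comod C) = zero C" "lact (coring_comod C) = lact C"
  "ract (coring_comod C) = ract C" "coact (coring_comod C) = comult C"
  by (simp_all add: coring_comod_def)

text \<open>Naturality of associativity in the first factor. It is stated on t \<otimes> z because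
  the coassociativity argument has split off the last factor, but not the first two, when it needs
  this.\<close>

lemma tensor_assoc_natural:
  assumes M: "right_module A M" and M': "right_module A M'" and N: "bimodule A N" and P: "left_module A P"
    and h: "right_linear A M M' h" and t: "t \<in> carrier (tensor A M N)" and z: "z \<in> carrier P"
  shows "tensor_assoc A M' N P (pure_tensor A (tensor A M' N) P (tensor_map A M' N h id t) z) =
    tensor_map A M' (tensor A N P) h id (tensor_assoc A M N P (pure_tensor A (tensor A M N) P t z))"
proof -
  interpret t: tensor_triple A M N P using M N P by (rule tensor_triple.intro)
  interpret t': tensor_triple A M' N P using M' N P by (rule tensor_triple.intro)
  interpret h: tensor_linear A M N M' N h id
    by (rule tensor_linear.intro[OF M t.N'(2) M' t.N'(2) h left_linear_id])
  interpret H: tensor_linear A M t.NP M' t.NP h id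
    by (rule tensor_linear.intro[OF M t.NP M' t.NP h left_linear_id])
  show ?thesis
    by (rule tensor_ext[OF M t.N'(2) t'.T
          additive_map_comp[OF h.tensor_map_additive
            additive_map_comp[OF t'.pure_tensor_additive_left[OF z] t'.tensor_assoc_additive]]
          additive_map_comp[OF t.pure_tensor_additive_left[OF z]
            additive_map_comp[OF t.tensor_assoc_additive H.tensor_map_additive]] _ t])
      (use z in \<open>simp_all add: h.tensor_map_pure H.tensor_map_pure t.tensor_assoc_pure_pure
        t'.tensor_assoc_pure_pure right_linear_closed[OF h] pure_tensor_closed t.N' P\<close>)
qed

context coring
begin

section \<open>The right submodule C S\<close>

lemma act_set_incl: "\<lbrakk>c \<in> carrier C; s \<in> S\<rbrakk> \<Longrightarrow> harpoon C c s \<in> act_set C S"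
  unfolding act_set_def by (rule generate.incl) blast

lemma act_set_gen_closed:
  "(\<And>s. s \<in> S \<Longrightarrow> dual s) \<Longrightarrow> {harpoon C c s | c s. c \<in> carrier C \<and> s \<in> S} \<subseteq> carrier C"
  by (auto intro: harpoon_closed)

lemma act_set_subgroup:
  assumes "\<And>s. s \<in> S \<Longrightarrow> dual s"
  shows "subgroup (act_set C S) (add_monoid C)"
  unfolding act_set_def
  by (rule group.generate_is_subgroup) (use act_set_gen_closed[OF assms] C.M.a_group in auto)

text \<open>Right linearity of the action gives (c s) a = (c a) s, so generators go to generators;
  the remaining cases carry this over to negatives and sums.\<close>

lemma act_set_ract:
  assumes S: "\<And>s. s \<in> S \<Longrightarrow> dual s" and x: "x \<in> act_set C S" and a: "a \<in> carrier A"
  shows "ract C x a \<in> act_set C S"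
proof -
  note sub = act_set_subgroup[of S, OF S]
  note inC = subgroup.mem_carrier[OF sub, simplified]
  from x[unfolded act_set_def] show ?thesis
  proof (induction x rule: generate.induct)
    case one
    have "ract C \<zero>\<^bsub>C\<^esub> a = \<zero>\<^bsub>C\<^esub>"
      using additive_map_zero[OF left_linear_additive[OF C.left_linear_ract[OF a]] C_group C_group] .
    then show ?case using subgroup.one_closed[OF sub] by simp
  next
    case (incl x)
    then obtain c s where "x = harpoon C c s" "c \<in> carrier C" "s \<in> S" by blast
    then show ?case
      using act_set_incl[OF C.ract_closed[OF a]] a
      by (simp add: right_linear_ract[OF harpoon_right_linear] S flip: right_linear_ract[OF harpoon_right_linear])
  next
    case (inv x)
    then obtain c s where cs: "x = harpoon C c s" "c \<in> carrier C" "s \<in> S" by blast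
    have "x \<in> carrier C" using cs harpoon_closed S by simp
    then have "ract C (\<ominus>\<^bsub>C\<^esub> x) a = \<ominus>\<^bsub>C\<^esub> (ract C x a)"
      using additive_map_minus[OF left_linear_additive[OF C.left_linear_ract[OF a]] C_group C_group] by simp
    moreover have "ract C x a = harpoon C (ract C c a) s"
      using cs a by (simp add: right_linear_ract[OF harpoon_right_linear] S)
    ultimately show ?case
      using subgroup.m_inv_closed[OF sub act_set_incl[OF C.ract_closed[OF a cs(2)] cs(3)]]
      by (simp add: a_inv_def)
  next
    case (eng x y)
    then show ?case
      using subgroup.m_closed[OF sub] inC[of x] inC[of y] a
      by (simp add: C.ract_add flip: act_set_def)
  qed
qed

end

section \<open>Factor modules\<close>

lemma factor_module_simps [simp]:
  "carrier (factor_module M K) = a_rcosets\<^bsub>M\<^esub> K" "\<zero>\<^bsub>factor_module M K\<^esub> = K"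
  "add (factor_module M K) = set_add M"
  "ract (factor_module M K) X a = K <+>\<^bsub>M\<^esub> ((\<lambda>x. ract M x a) ` X)"
  by (simp_all add: factor_module_def)

lemma factor_comodule_simps [simp]:
  "carrier (factor_comodule A C M K) = a_rcosets\<^bsub>M\<^esub> K" "\<zero>\<^bsub>factor_comodule A C M K\<^esub> = K"
  "add (factor_comodule A C M K) = set_add M"
  "ract (factor_comodule A C M K) = ract (factor_module M K)"
  "lact (factor_comodule A C M K) = lact (factor_module M K)"
  "coact (factor_comodule A C M K) X = the_elem
     ((\<lambda>m. tensor_map A (factor_module M K) C (\<lambda>x. K +>\<^bsub>M\<^esub> x) id (coact M m)) ` X)"
  by (simp_all add: factor_comodule_def bimod.defs comod.defs)

lemma right_module_factor:
  assumes M: "right_module A M" and K: "subgroup K (add_monoid M)"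
    and ract: "\<And>x a. \<lbrakk>x \<in> K; a \<in> carrier A\<rbrakk> \<Longrightarrow> ract M x a \<in> K"
  shows "right_module A (factor_module M K)"
    and "right_linear A M (factor_module M K) (\<lambda>x. K +>\<^bsub>M\<^esub> x)"
proof -
  interpret M: right_module A M by fact
  interpret K: abelian_subgroup K M
    using K by (intro abelian_subgroupI3 additive_subgroup.intro M.M.abelian_group_axioms)
  have inM: "x \<in> K \<Longrightarrow> x \<in> carrier M" for x using K.a_subset by blast
  \<comment> \<open>For one inclusion the representative x itself lies in its coset. For the other,
    the K-part k' of an element of the coset contributes k' a, which stays in K.\<close>
  have 1: "ract (factor_module M K) (K +>\<^bsub>M\<^esub> x) a = K +>\<^bsub>M\<^esub> ract M x a"
    if x: "x \<in> carrier M" and a: "a \<in> carrier A" for x a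
  proof (intro subset_antisym subsetI)
    fix y assume "y \<in> K +>\<^bsub>M\<^esub> ract M x a"
    then obtain k where "k \<in> K" "y = k \<oplus>\<^bsub>M\<^esub> ract M x a" by (auto simp: a_r_coset_def')
    then show "y \<in> ract (factor_module M K) (K +>\<^bsub>M\<^esub> x) a"
      using K.a_rcos_self[OF x] by (auto simp: set_add_def')
  next
    fix y assume "y \<in> ract (factor_module M K) (K +>\<^bsub>M\<^esub> x) a"
    then obtain k k' where k: "k \<in> K" "k' \<in> K" "y = k \<oplus>\<^bsub>M\<^esub> ract M (k' \<oplus>\<^bsub>M\<^esub> x) a"
      by (auto simp: set_add_def' a_r_coset_def')
    then have "y = (k \<oplus>\<^bsub>M\<^esub> ract M k' a) \<oplus>\<^bsub>M\<^esub> ract M x a"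
      using x a by (simp add: inM M.ract_add M.ract_closed M.M.a_assoc)
    then show "y \<in> K +>\<^bsub>M\<^esub> ract M x a"
      using k(1,2) ract a by (auto simp: a_r_coset_def')
  qed
  have "carrier (factor_module M K) = (\<lambda>x. K +>\<^bsub>M\<^esub> x) ` carrier M"
    by (auto simp: A_RCOSETS_def')
  moreover have "\<zero>\<^bsub>factor_module M K\<^esub> = K +>\<^bsub>M\<^esub> \<zero>\<^bsub>M\<^esub>"
    using K.a_subset by simp
  moreover have "(K +>\<^bsub>M\<^esub> x) \<oplus>\<^bsub>factor_module M K\<^esub> (K +>\<^bsub>M\<^esub> y) = K +>\<^bsub>M\<^esub> (x \<oplus>\<^bsub>M\<^esub> y)"
    if "x \<in> carrier M" "y \<in> carrier M" for x y
    using K.a_rcos_sum[OF that] by simp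
  ultimately show "right_module A (factor_module M K)"
    "right_linear A M (factor_module M K) (\<lambda>x. K +>\<^bsub>M\<^esub> x)"
    using right_module_image[OF M, of "factor_module M K" "\<lambda>x. K +>\<^bsub>M\<^esub> x"] 1 by blast+
qed

context coring
begin

section \<open>The coaction on C S\<close>

text \<open>Preimages of \<Delta>(x) in K \<otimes> C exist because c \<mapsto> c s is colinear with
  values in K, and they are unique by flatness. Uniqueness gives linearity of the chosen coaction;
  coassociativity is verified on the generators; the counit law is compared inside C.\<close>

lemma subcomodule_act_set:
  assumes flat: "flat_left_module A C" and S: "\<And>s. s \<in> S \<Longrightarrow> dual s"
  shows "subcomodule A C (coring_comod C) (act_set C S)"
proof -
  let ?K = "act_set C S"
  note sub = act_set_subgroup[of S, OF S]
  have inC: "x \<in> ?K \<Longrightarrow> x \<in> carrier C" for x using subgroup.mem_carrier[OF sub] by simp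
  \<comment> \<open>The module is indexed by a coaction still to be found. By
    \<open>tensor_K\<close> its tensor product with C does not depend on that index, so preimages
    can be constructed over \<open>K undefined\<close> and used over
    \<open>K \<rho>\<close>.\<close>
  define K where "K \<rho> = (coring_comod C)\<lparr>carrier := ?K, coact := \<rho>\<rparr>" for \<rho> :: "'c \<Rightarrow> ('c, 'c) tens"
  have K_simps: "carrier (K \<rho>) = ?K" "add (K \<rho>) = add C" "zero (K \<rho>) = zero C"
    "lact (K \<rho>) = lact C" "bimod.ract (K \<rho>) = bimod.ract C" "coact (K \<rho>) = \<rho>" for \<rho>
    by (simp_all add: K_def)
  have KR: "right_module A (K \<rho>)" for \<rho>
    by (rule C.right_module_submodule[OF sub act_set_ract[OF S]]) (simp_all add: K_simps)
  have tensor_K: "tensor A (K \<rho>) C = tensor A (K \<sigma>) C" for \<rho> \<sigma>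
    by (rule tensor_left_cong) (simp_all add: K_simps)
  have incl: "right_linear A (K \<rho>) C id" for \<rho>
    by (intro right_linearI additive_mapI) (simp_all add: K_simps inC)
  have hK: "right_linear A C (K \<rho>) (\<lambda>c. harpoon C c s)" if "s \<in> S" for s \<rho>
    using harpoon_right_linear[OF S[OF that]] act_set_incl[of _ s S] that
    by (auto simp: right_linear_def additive_map_def K_simps)
  have J: "tensor_linear A (K \<rho>) C C C id id" for \<rho>
    by (rule tensor_linear.intro[OF KR C_left C_right C_left incl left_linear_id])
  let ?J = "tensor_map A C C id id"
  note J_add = tensor_linear.tensor_map_add[OF J]
  have J_inj: "inj_on ?J (carrier (tensor A (K \<rho>) C))" for \<rho>
    by (rule flat_tensor_map_inj[OF flat KR C_right incl]) simp
  have h_tl: "tensor_linear A C C (K \<rho>) C (\<lambda>c. harpoon C c s) id" if "s \<in> S" for s \<rho>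
    by (rule tensor_linear.intro[OF C_right C_left KR C_left hK[OF that] left_linear_id])
  \<comment> \<open>A preimage of \<Delta>(c s) in K \<otimes> C: apply c \<mapsto> c s, regarded as
    a map into K, to the left factor of \<Delta>(c).\<close>
  have J_h: "?J (tensor_map A (K \<rho>) C (\<lambda>c. harpoon C c s) id (comult C c)) = comult C (harpoon C c s)"
    if "s \<in> S" "c \<in> carrier C" for s c \<rho>
    using tensor_map_comp[OF h_tl[OF that(1)] J comult_closed[OF that(2)], of \<rho>]
      comult_harpoon[OF S that(2)] that(1) by (simp add: id_def)
  \<comment> \<open>The elements of K whose comultiplication lifts to K \<otimes> C form a subgroup,
    and it contains the generators by \<open>J_h\<close>.\<close>
  have "\<exists>t\<in>carrier (tensor A (K undefined) C). ?J t = comult C x" if "x \<in> ?K" for x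
  proof -
    let ?T = "tensor A (K undefined) C"
    interpret T: abelian_group ?T by (rule abelian_group_tensor[OF KR C_left])
    have AT: "abelian_group CC" by (rule abelian_group_tensor[OF C_right C_left])
    note Jadd = tensor_linear.tensor_map_additive[OF J]
    note comult_add = right_linear_additive[OF comult_right_linear]
    from that[unfolded act_set_def] show ?thesis
    proof (induction x rule: generate.induct)
      case one
      have "?J \<zero>\<^bsub>?T\<^esub> = comult C \<zero>\<^bsub>C\<^esub>"
        using additive_map_zero[OF Jadd T.abelian_group_axioms AT] additive_map_zero[OF comult_add C_group AT]
        by metis
      then show ?case
        unfolding monoid.select_convs using T.zero_closed by blast
    next
      case (incl x)
      then obtain c s where cs: "x = harpoon C c s" "c \<in> carrier C" "s \<in> S" by blast
      show ?case
        unfolding cs(1) using tensor_linear.tensor_map_closed[OF h_tl[OF cs(3)] comult_closed[OF cs(2)]]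
        by (rule bexI[rotated]) (rule J_h[OF cs(3,2)])
    next
      case (inv x)
      then obtain c s where cs: "x = harpoon C c s" "c \<in> carrier C" "s \<in> S" by blast
      let ?t = "tensor_map A (K undefined) C (\<lambda>c. harpoon C c s) id (comult C c)"
      have t: "?t \<in> carrier ?T"
        using tensor_linear.tensor_map_closed[OF h_tl[OF cs(3)] comult_closed[OF cs(2)]] .
      have "x \<in> carrier C" using cs S harpoon_closed by simp
      then have "?J (\<ominus>\<^bsub>?T\<^esub> ?t) = comult C (\<ominus>\<^bsub>C\<^esub> x)"
        using additive_map_minus[OF Jadd T.abelian_group_axioms AT t] J_h[OF cs(3,2)]
          additive_map_minus[OF comult_add C_group AT, of x] cs(1) by metis
      then show ?case
        unfolding a_inv_def[of C, symmetric] using T.a_inv_closed[OF t] by blast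
    next
      case (eng x y)
      then obtain t u where tu: "t \<in> carrier ?T" "?J t = comult C x" "u \<in> carrier ?T" "?J u = comult C y"
        by blast
      have "x \<in> carrier C" "y \<in> carrier C"
        using eng(1,2) inC unfolding act_set_def by auto
      then have "?J (t \<oplus>\<^bsub>?T\<^esub> u) = comult C (x \<oplus>\<^bsub>C\<^esub> y)"
        using J_add[OF tu(1,3)] tu(2,4) additive_map_add[OF comult_add, of x y] by metis
      then show ?case
        unfolding monoid.select_convs using T.a_closed[OF tu(1,3)] by blast
    qed
  qed
  then obtain \<rho> where \<rho>0: "\<And>x. x \<in> ?K \<Longrightarrow> \<rho> x \<in> carrier (tensor A (K undefined) C)"
    and J_\<rho>: "\<And>x. x \<in> ?K \<Longrightarrow> ?J (\<rho> x) = comult C x"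
    by metis
  let ?M = "K \<rho>"
  let ?T = "tensor A ?M C"
  have \<rho>: "\<rho> x \<in> carrier ?T" if "x \<in> ?K" for x
    using \<rho>0[OF that] tensor_K[of \<rho> undefined] by simp
  interpret M: right_module A ?M by (rule KR)
  interpret T: abelian_group ?T by (rule abelian_group_tensor[OF KR C_left])
  have RT: "right_module A ?T" by (rule right_module_tensor[OF KR C_bimod])
  have LT: "left_module A CC" by (rule left_module_tensor[OF C_bimod C_left])
  have RCC: "right_module A CC" by (rule right_module_tensor[OF C_right C_bimod])
  note J_injD = inj_onD[OF J_inj[of \<rho>]]
  \<comment> \<open>After the injective map \<open>?J\<close> both laws become laws of
    \<Delta>.\<close>
  have \<rho>_linear: "right_linear A ?M ?T \<rho>"
  proof (intro right_linearI additive_mapI)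
    fix x assume x: "x \<in> carrier ?M"
    then show "\<rho> x \<in> carrier ?T" by (simp add: K_simps \<rho>)
    fix y assume y: "y \<in> carrier ?M"
    have "x \<oplus>\<^bsub>?M\<^esub> y \<in> ?K" using M.M.a_closed[OF x y] by (simp add: K_simps)
    moreover have "x \<in> ?K" "y \<in> ?K" using x y by (simp_all add: K_simps)
    moreover from this have "?J (\<rho> x \<oplus>\<^bsub>?T\<^esub> \<rho> y) = comult C (x \<oplus>\<^bsub>?M\<^esub> y)"
      using J_add[OF \<rho> \<rho>, of x y] right_linear_add[OF comult_right_linear inC inC, of x y]
      by (metis J_\<rho> K_simps(2))
    ultimately show "\<rho> (x \<oplus>\<^bsub>?M\<^esub> y) = \<rho> x \<oplus>\<^bsub>?T\<^esub> \<rho> y"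
      using J_injD[OF _ \<rho> T.a_closed[OF \<rho> \<rho>]] J_\<rho> by metis
  next
    fix x a assume x: "x \<in> carrier ?M" and a: "a \<in> carrier A"
    have J_ract: "?J (bimod.ract ?T t a) = bimod.ract CC (?J t) a" if "t \<in> carrier ?T" for t
      by (rule tensor_ext[OF KR C_left abelian_group_tensor[OF C_right C_left]
            additive_map_comp[OF ract_tensor_additive[OF KR C_bimod a] tensor_linear.tensor_map_additive[OF J]]
            additive_map_comp[OF tensor_linear.tensor_map_additive[OF J] ract_tensor_additive[OF C_right C_bimod a]] _ that])
        (simp add: ract_pure_tensor[OF KR C_bimod a] ract_pure_tensor[OF C_right C_bimod a] tensor_linear.tensor_map_pure[OF J]
          C.ract_closed a K_simps inC)
    have "bimod.ract ?M x a \<in> ?K" using M.ract_closed[OF a x] by (simp add: K_simps)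
    moreover have xK: "x \<in> ?K" using x by (simp add: K_simps)
    moreover from xK have "?J (bimod.ract ?T (\<rho> x) a) = comult C (bimod.ract ?M x a)"
      using J_ract[OF \<rho>] right_linear_ract[OF comult_right_linear inC a, of x]
      by (metis J_\<rho> K_simps(5))
    ultimately show "\<rho> (bimod.ract ?M x a) = bimod.ract ?T (\<rho> x) a"
      using J_injD[OF _ \<rho> right_module.ract_closed[OF RT a \<rho>]] J_\<rho> by metis
  qed
  \<comment> \<open>The chosen preimage must be the explicit one of \<open>J_h\<close>, by
    injectivity.\<close>
  have \<rho>_harpoon: "\<rho> (harpoon C c s) = tensor_map A ?M C (\<lambda>c. harpoon C c s) id (comult C c)"
    if "s \<in> S" "c \<in> carrier C" for c s
    using J_injD[OF _ \<rho> tensor_linear.tensor_map_closed[OF h_tl[OF that(1)] comult_closed[OF that(2)]]]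
      act_set_incl[OF that(2,1)] J_\<rho> J_h[OF that] by metis
  have \<rho>_tl: "tensor_linear A ?M C ?T C \<rho> id"
    by (rule tensor_linear.intro[OF KR C_left RT C_left \<rho>_linear left_linear_id])
  have comult_tl: "tensor_linear A ?M C ?M CC id (comult C)"
    by (rule tensor_linear.intro[OF KR C_left KR LT right_linear_id comult_left_linear])
  interpret M3: tensor_triple A ?M C C by (rule tensor_triple.intro[OF KR C_bimod C_left])
  interpret C3: tensor_triple A C C C by (rule tensor_triple.intro[OF C_right C_bimod C_left])
  \<comment> \<open>On a generator x = c s both sides are images of \<Delta>(c): naturality of
    associativity pulls the map c \<mapsto> c s out to the left factor, and coassociativity of C is
    applied underneath it.\<close>
  have coassoc: "tensor_assoc A ?M C C (tensor_map A ?T C \<rho> id (\<rho> x)) = tensor_map A ?M CC id (comult C) (\<rho> x)"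
    if x: "x \<in> ?K" for x
  proof (rule additive_map_generate_eq[OF C_group M3.T act_set_gen_closed[of S, OF S], of ?M])
    show "additive_map ?M (tensor A ?M CC) (\<lambda>x. tensor_assoc A ?M C C (tensor_map A ?T C \<rho> id (\<rho> x)))"
      by (intro additive_map_comp[OF right_linear_additive[OF \<rho>_linear]]
          additive_map_comp[OF tensor_linear.tensor_map_additive[OF \<rho>_tl]] M3.tensor_assoc_additive)
    show "additive_map ?M (tensor A ?M CC) (\<lambda>x. tensor_map A ?M CC id (comult C) (\<rho> x))"
      by (rule additive_map_comp[OF right_linear_additive[OF \<rho>_linear]
            tensor_linear.tensor_map_additive[OF comult_tl]])
    fix x assume "x \<in> {harpoon C c s |c s. c \<in> carrier C \<and> s \<in> S}"
    then obtain c s where cs: "x = harpoon C c s" "c \<in> carrier C" "s \<in> S" by blast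
    let ?h = "\<lambda>c. harpoon C c s"
    note h = hK[OF cs(3), of \<rho>] and htl = h_tl[OF cs(3), of \<rho>]
    have H: "tensor_linear A C CC ?M CC ?h id"
      by (rule tensor_linear.intro[OF C_right LT KR LT h left_linear_id])
    have D: "tensor_linear A C C CC C (comult C) id"
      by (rule tensor_linear.intro[OF C_right C_left RCC C_left comult_right_linear left_linear_id])
    have E: "tensor_linear A C C C CC id (comult C)"
      by (rule tensor_linear.intro[OF C_right C_left C_right LT right_linear_id comult_left_linear])
    have F: "tensor_linear A C C ?T C (\<lambda>c. \<rho> (?h c)) id"
      by (rule tensor_linear.intro[OF C_right C_left RT C_left right_linear_comp[OF h \<rho>_linear] left_linear_id])
    have "tensor_assoc A ?M C C (tensor_map A ?T C \<rho> id (\<rho> x)) =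
        tensor_assoc A ?M C C (tensor_map A ?T C (\<lambda>c. \<rho> (?h c)) id (comult C c))"
      using tensor_map_comp[OF htl \<rho>_tl comult_closed[OF cs(2)]]
      by (simp add: cs \<rho>_harpoon id_def)
    also have "\<dots> = tensor_map A ?M CC ?h id (tensor_assoc A C C C (tensor_map A CC C (comult C) id (comult C c)))"
      by (rule tensor_ext[OF C_right C_left M3.T
            additive_map_comp[OF tensor_linear.tensor_map_additive[OF F] M3.tensor_assoc_additive]
            additive_map_comp[OF tensor_linear.tensor_map_additive[OF D]
              additive_map_comp[OF C3.tensor_assoc_additive tensor_linear.tensor_map_additive[OF H]]]
            _ comult_closed[OF cs(2)]])
        (simp add: tensor_linear.tensor_map_pure[OF F] tensor_linear.tensor_map_pure[OF D] \<rho>_harpoon cs(3)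
          tensor_assoc_natural[OF C_right KR C_bimod C_left h] comult_closed)
    also have "\<dots> = tensor_map A ?M CC ?h id (tensor_map A C CC id (comult C) (comult C c))"
      using coassociative[OF cs(2)] by simp
    also have "\<dots> = tensor_map A ?M CC id (comult C) (tensor_map A ?M C ?h id (comult C c))"
      using tensor_map_comp[OF E H comult_closed[OF cs(2)]] tensor_map_comp[OF htl comult_tl comult_closed[OF cs(2)]]
      by (simp add: id_def)
    finally show "tensor_assoc A ?M C C (tensor_map A ?T C \<rho> id (\<rho> x)) = tensor_map A ?M CC id (comult C) (\<rho> x)"
      by (simp add: cs \<rho>_harpoon)
  qed (use x in \<open>simp_all add: K_simps act_set_def\<close>)
  have counit: "tensor_lift ?M (\<lambda>x c. bimod.ract ?M x (counit C c)) (\<rho> x) = x" if x: "x \<in> ?K" for x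
  proof -
    have b: "balanced_map A X C X (\<lambda>x c. bimod.ract X x (counit C c))" if "right_module A X"
      for X :: "('a, 'c, 'd) bimod_scheme"
    proof -
      interpret X: right_module A X by fact
      show ?thesis
        by (rule balanced_map.intro)
          (simp_all add: that C_left X.abelian_group_axioms X.ract_closed X.ract_add X.ract_add_scalar X.ract_mult
            left_linear_closed[OF counit_left_linear, simplified]
            left_linear_add[OF counit_left_linear, simplified]
            left_linear_lact[OF counit_left_linear, simplified])
    qed
    have MC: "additive_map ?M C (\<lambda>x. x)"
      by (rule additive_mapI) (simp_all add: K_simps inC)
    \<comment> \<open>Both sides send x \<otimes> c to x \<epsilon>(c), computed once in K and once
      in C. For the tensor \<rho>(x) the right side is the counit law of C.\<close>
    have "tensor_lift ?M (\<lambda>x c. bimod.ract ?M x (counit C c)) t =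
        tensor_lift C (\<lambda>x c. bimod.ract C x (counit C c)) (?J t)" if "t \<in> carrier ?T" for t
      by (rule tensor_ext[OF KR C_left C_group
            additive_map_comp[OF balanced_map.tensor_lift_additive[OF b[OF KR]] MC]
            additive_map_comp[OF tensor_linear.tensor_map_additive[OF J]
              balanced_map.tensor_lift_additive[OF b[OF C_right]]] _ that])
        (simp add: balanced_map.tensor_lift_pure[OF b[OF KR], simplified K_simps] tensor_linear.tensor_map_pure[OF J]
          balanced_map.tensor_lift_pure[OF b[OF C_right]] K_simps inC)
    then show ?thesis using x by (simp add: \<rho> J_\<rho> counit_right inC)
  qed
  have "right_comodule A C ?M"
    by (intro right_comodule.intro right_comodule_axioms.intro coring_axioms KR)
      (use \<rho>_linear coassoc counit in \<open>simp_all add: K_simps\<close>)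
  moreover have "colinear A C ?M (coring_comod C) id"
    using incl[of \<rho>] J_\<rho>
    by (simp add: colinear_def right_linear_def additive_map_def K_simps
        tensor_left_cong(3)[of "coring_comod C" C A C])
  ultimately show ?thesis
    using inC by (auto simp: subcomodule_def K_def)
qed

section \<open>Colinear maps from a factor comodule to the coring\<close>

text \<open>The composite of h with the projection p is a colinear endomorphism of C, so
  \<open>harpoon_colinear\<close> with g = \<epsilon> represents it. Most of the work is to show
  that p is colinear, since the coaction of the factor is given only through \<open>the_elem\<close>
  of an image of a coset.\<close>

lemma factor_comodule_hom_harpoon:
  assumes K: "subcomodule A C (coring_comod C) K"
    and h: "h \<in> comod_Hom A C (factor_comodule A C (coring_comod C) K) (coring_comod C)"
  obtains s where "s \<in> carrier D" "\<And>c. c \<in> carrier C \<Longrightarrow> h (K +>\<^bsub>C\<^esub> c) = harpoon C c s"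
proof -
  obtain \<rho> where \<rho>: "right_comodule A C ((coring_comod C)\<lparr>carrier := K, coact := \<rho>\<rparr>)"
      "colinear A C ((coring_comod C)\<lparr>carrier := K, coact := \<rho>\<rparr>) (coring_comod C) id"
    and K_sub: "K \<subseteq> carrier C"
    using K by (auto simp: subcomodule_def)
  define M where "M = (coring_comod C)\<lparr>carrier := K, coact := \<rho>\<rparr>"
  interpret M: right_comodule A C M unfolding M_def by (rule \<rho>(1))
  have M_simps: "carrier M = K" "add M = add C" "zero M = zero C" "bimod.ract M = bimod.ract C"
    "coact M = \<rho>" by (simp_all add: M_def)
  have MR: "right_module A M" by (rule M.M.right_module_axioms)
  define F where "F = factor_module (coring_comod C) K"
  define p where "p x = K +>\<^bsub>coring_comod C\<^esub> x" for x
  have p: "p x = K +>\<^bsub>C\<^esub> x" for x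
    by (simp add: p_def a_r_coset_def')
  \<comment> \<open>The submodule has the zero and addition of C, but its negatives are determined
    within K; they agree with those of C by uniqueness of inverses.\<close>
  have sub: "subgroup K (add_monoid C)"
  proof (intro group.subgroupI C.M.a_group)
    show "inv\<^bsub>add_monoid C\<^esub> x \<in> K" if "x \<in> K" for x
    proof -
      have "x \<in> carrier M" using that by (simp add: M_simps)
      then have "\<ominus>\<^bsub>M\<^esub> x \<in> K" "\<ominus>\<^bsub>M\<^esub> x \<oplus>\<^bsub>C\<^esub> x = \<zero>\<^bsub>C\<^esub>"
        using M.M.M.a_inv_closed[of x] M.M.M.l_neg[of x] by (simp_all add: M_simps)
      then show ?thesis
        using C.M.minus_equality[of "\<ominus>\<^bsub>M\<^esub> x" x] K_sub that by (auto simp: a_inv_def[of C] subset_iff)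
    qed
    show "K \<noteq> {}" using M.M.M.zero_closed by (auto simp: M_simps)
    show "x \<otimes>\<^bsub>add_monoid C\<^esub> y \<in> K" if "x \<in> K" "y \<in> K" for x y
      using M.M.M.a_closed[of x y] that by (simp add: M_simps)
  qed (use K_sub in simp)
  have CR: "right_module A (coring_comod C)"
    by (rule right_module_image(1)[OF C_right, of _ id]) simp_all
  have subcc: "subgroup K (add_monoid (coring_comod C))"
    using sub by (simp add: subgroup_def m_inv_def)
  have ractK: "bimod.ract C x a \<in> K" if "x \<in> K" "a \<in> carrier A" for x a
    using M.M.ract_closed[of a x] that by (simp add: M_simps)
  have FR: "right_module A F" and p_lin: "right_linear A C F p"
    using right_module_factor[OF CR subcc] ractK
    unfolding F_def p_def by (simp_all add: right_linear_def additive_map_def)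
  have p_tl: "tensor_linear A C C F C p id"
    by (rule tensor_linear.intro[OF C_right C_left FR C_left p_lin left_linear_id])
  let ?\<phi> = "\<lambda>m. tensor_map A F C p id (comult C m)"
  have FT: "abelian_group (tensor A F C)" by (rule abelian_group_tensor[OF FR C_left])
  have \<phi>: "additive_map C (tensor A F C) ?\<phi>"
    by (rule additive_map_comp[OF right_linear_additive[OF comult_right_linear]
          tensor_linear.tensor_map_additive[OF p_tl]])
  have pK: "p x = \<zero>\<^bsub>F\<^esub>" if "x \<in> K" for x
    using C.M.a_coset_join2[of x K] sub that K_sub by (auto simp: p F_def)
  \<comment> \<open>For x in K, \<Delta>(x) comes from the tensor \<rho>(x) over K, and p
    annihilates the left entry of every pure tensor over K.\<close>
  have \<phi>K: "?\<phi> x = \<zero>\<^bsub>tensor A F C\<^esub>" if x: "x \<in> K" for x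
  proof -
    have incl: "right_linear A M C id"
      using K_sub by (intro right_linearI additive_mapI) (auto simp: M_simps)
    have i_tl: "tensor_linear A M C C C id id"
      by (rule tensor_linear.intro[OF MR C_left C_right C_left incl left_linear_id])
    have pM_tl: "tensor_linear A M C F C p id"
      using right_linear_comp[OF incl p_lin] by (intro tensor_linear.intro[OF MR C_left FR C_left _ left_linear_id]) simp
    have \<rho>x: "\<rho> x \<in> carrier (tensor A M C)"
      using right_linear_closed[OF M.coact_right_linear, of x] x by (simp add: M_simps)
    have "comult C x = tensor_map A C C id id (\<rho> x)"
      using \<rho>(2) x by (simp add: colinear_def tensor_left_cong(3)[of "coring_comod C" C A C])
    then have "?\<phi> x = tensor_map A F C p id (\<rho> x)"
      using tensor_map_comp[OF i_tl p_tl \<rho>x] by (simp add: id_def)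
    also have "\<dots> = \<zero>\<^bsub>tensor A F C\<^esub>"
    proof (rule tensor_ext[OF MR C_left FT tensor_linear.tensor_map_additive[OF pM_tl] _ _ \<rho>x])
      interpret FT: abelian_group "tensor A F C" by (rule FT)
      show "additive_map (tensor A M C) (tensor A F C) (\<lambda>_. \<zero>\<^bsub>tensor A F C\<^esub>)"
        by (rule additive_mapI) simp_all
      fix x y assume xy: "x \<in> carrier M" "y \<in> carrier C"
      interpret F: right_module A F by (rule FR)
      have "additive_map F (tensor A F C) (\<lambda>u. pure_tensor A F C u y)"
        using pure_tensor_balanced[OF FR C_left] xy(2)
        by (intro additive_mapI) (simp_all add: balanced_map.closed balanced_map.add_left)
      then have "pure_tensor A F C \<zero>\<^bsub>F\<^esub> y = \<zero>\<^bsub>tensor A F C\<^esub>"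
        using additive_map_zero F.M.abelian_group_axioms FT by blast
      then show "tensor_map A F C p id (pure_tensor A M C x y) = \<zero>\<^bsub>tensor A F C\<^esub>"
        using xy pK by (simp add: tensor_linear.tensor_map_pure[OF pM_tl] M_simps)
    qed
    finally show ?thesis .
  qed
  \<comment> \<open>Two members of a coset differ by an element of K, so by \<phi>K the map is
    constant on the coset and \<open>the_elem\<close> yields its value at c.\<close>
  have coact_p: "coact (factor_comodule A C (coring_comod C) K) (p c) = ?\<phi> c" if c: "c \<in> carrier C" for c
  proof -
    interpret FT: abelian_group "tensor A F C" by (rule FT)
    have const: "?\<phi> x = ?\<phi> c" if x: "x \<in> p c" for x
    proof -
      obtain k where k: "k \<in> K" "x = k \<oplus>\<^bsub>C\<^esub> c" using x by (auto simp: p a_r_coset_def')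
      then show ?thesis
        using additive_map_add[OF \<phi>, of k c] \<phi>K[OF k(1)] K_sub c additive_map_closed[OF \<phi> c]
        by auto
    qed
    have self: "c \<in> p c"
      using C.M.add.rcos_self[OF _ sub] c by (simp add: p a_r_coset_def)
    have "?\<phi> ` p c = (\<lambda>_. ?\<phi> c) ` p c" by (rule image_cong[OF refl const])
    also have "\<dots> = {?\<phi> c}" using self by blast
    finally show ?thesis by (simp add: F_def[symmetric] p_def[symmetric])
  qed
  have h_lin: "right_linear A F C h"
    using h by (simp add: comod_Hom_def colinear_def right_linear_def additive_map_def F_def)
  have h_co: "comult C (h X) = tensor_map A C C h id (coact (factor_comodule A C (coring_comod C) K) X)"
    if "X \<in> carrier F" for X
    using h that
    by (simp add: comod_Hom_def colinear_def F_def tensor_left_cong(3)[of "coring_comod C" C A C]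
        del: factor_comodule_simps(6))
  have hp: "right_linear A C C (\<lambda>c. h (p c))" by (rule right_linear_comp[OF p_lin h_lin])
  define s where "s = restrict (\<lambda>c. counit C (h (p c))) (carrier C)"
  have dual: "dual (\<lambda>c. counit C (h (p c)))" by (rule right_linear_comp[OF hp dual_counit])
  have h_tl: "tensor_linear A F C C C h id"
    by (rule tensor_linear.intro[OF FR C_left C_right C_left h_lin left_linear_id])
  have "h (p c) = harpoon C c s" if c: "c \<in> carrier C" for c
  proof -
    have "comult C (h (p c)) = tensor_map A C C (\<lambda>c. h (p c)) id (comult C c)"
      using h_co[of "p c"] right_linear_closed[OF p_lin c] coact_p[OF c]
        tensor_map_comp[OF p_tl h_tl comult_closed[OF c]]
      by (simp add: id_def)
    then have "harpoon C (h (p c)) (counit C) = harpoon C c (\<lambda>c. counit C (h (p c)))"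
      by (rule harpoon_colinear[OF hp dual_counit c])
    also have "\<dots> = harpoon C c s"
      using c dual by (intro harpoon_cong) (simp_all add: s_def dual_restrict)
    finally show ?thesis
      using harpoon_counit[OF right_linear_closed[OF hp c]] by simp
  qed
  then show thesis
    using that[of s] dual by (simp add: p s_def dual_ring_carrier dual_restrict)
qed

end

section \<open>Elementwise characterisations of the ring-theoretic conditions\<close>

context ring
begin

lemma ideal_prod_eq_zeroI:
  assumes "ideal I R" "ideal J R" "\<And>x y. \<lbrakk>x \<in> I; y \<in> J\<rbrakk> \<Longrightarrow> x \<otimes> y = \<zero>"
  shows "ideal_prod R I J = {\<zero>}"
proof -
  have "x = \<zero>" if "x \<in> ideal_prod R I J" for x
    using that by (induction rule: ideal_prod.induct) (simp_all add: assms(3))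
  moreover have "\<zero> \<in> ideal_prod R I J"
    using additive_subgroup.zero_closed[OF ideal.axioms(1)[OF ideal_prod_is_ideal[OF assms(1,2)]]] .
  ultimately show ?thesis by blast
qed

text \<open>The middle factor h makes the annihilator two-sided: multiplying x on the right by a
  ring element is absorbed into h.\<close>

lemma ideal_left_annihilator:
  assumes "G \<subseteq> carrier R"
  shows "ideal {x \<in> carrier R. \<forall>h\<in>carrier R. \<forall>g\<in>G. x \<otimes> h \<otimes> g = \<zero>} R"
proof (rule idealI[OF ring_axioms])
  show "subgroup {x \<in> carrier R. \<forall>h\<in>carrier R. \<forall>g\<in>G. x \<otimes> h \<otimes> g = \<zero>} (add_monoid R)"
    using assms by (intro add.subgroupI)
      (auto simp: l_distr l_minus subset_iff a_inv_def[symmetric] intro!: exI[of _ \<zero>])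
next
  fix a x assume "a \<in> {x \<in> carrier R. \<forall>h\<in>carrier R. \<forall>g\<in>G. x \<otimes> h \<otimes> g = \<zero>}" and x: "x \<in> carrier R"
  then have a: "a \<in> carrier R" "\<And>h g. \<lbrakk>h \<in> carrier R; g \<in> G\<rbrakk> \<Longrightarrow> a \<otimes> h \<otimes> g = \<zero>" by auto
  have "x \<otimes> a \<otimes> h \<otimes> g = \<zero>" if "h \<in> carrier R" "g \<in> G" for h g
    using a(2)[OF that] that assms x a(1) by (auto simp: m_assoc)
  moreover have "a \<otimes> x \<otimes> h \<otimes> g = \<zero>" if "h \<in> carrier R" "g \<in> G" for h g
    using a(2)[of "x \<otimes> h" g] that assms x a(1) by (auto simp: m_assoc)
  ultimately show "x \<otimes> a \<in> {x \<in> carrier R. \<forall>h\<in>carrier R. \<forall>g\<in>G. x \<otimes> h \<otimes> g = \<zero>}"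
    "a \<otimes> x \<in> {x \<in> carrier R. \<forall>h\<in>carrier R. \<forall>g\<in>G. x \<otimes> h \<otimes> g = \<zero>}"
    using x a(1) by auto
qed

lemma ideal_right_annihilator:
  assumes "G \<subseteq> carrier R"
  shows "ideal {x \<in> carrier R. \<forall>h\<in>carrier R. \<forall>g\<in>G. g \<otimes> h \<otimes> x = \<zero>} R"
proof (rule idealI[OF ring_axioms])
  show "subgroup {x \<in> carrier R. \<forall>h\<in>carrier R. \<forall>g\<in>G. g \<otimes> h \<otimes> x = \<zero>} (add_monoid R)"
    using assms by (intro add.subgroupI)
      (auto simp: r_distr r_minus subset_iff a_inv_def[symmetric] intro!: exI[of _ \<zero>])
next
  fix a x assume "a \<in> {x \<in> carrier R. \<forall>h\<in>carrier R. \<forall>g\<in>G. g \<otimes> h \<otimes> x = \<zero>}" and x: "x \<in> carrier R"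
  then have a: "a \<in> carrier R" "\<And>h g. \<lbrakk>h \<in> carrier R; g \<in> G\<rbrakk> \<Longrightarrow> g \<otimes> h \<otimes> a = \<zero>" by auto
  have "g \<otimes> h \<otimes> (x \<otimes> a) = \<zero>" if "h \<in> carrier R" "g \<in> G" for h g
    using a(2)[of "h \<otimes> x" g] that assms x a(1) by (auto simp: m_assoc)
  moreover have "g \<otimes> h \<otimes> (a \<otimes> x) = \<zero>" if "h \<in> carrier R" "g \<in> G" for h g
  proof -
    have "g \<otimes> h \<otimes> (a \<otimes> x) = (g \<otimes> h \<otimes> a) \<otimes> x"
      using that assms x a(1) by (auto simp: m_assoc)
    then show ?thesis using a(2)[OF that] x by simp
  qed
  ultimately show "x \<otimes> a \<in> {x \<in> carrier R. \<forall>h\<in>carrier R. \<forall>g\<in>G. g \<otimes> h \<otimes> x = \<zero>}"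
    "a \<otimes> x \<in> {x \<in> carrier R. \<forall>h\<in>carrier R. \<forall>g\<in>G. g \<otimes> h \<otimes> x = \<zero>}"
    using x a(1) by auto
qed

text \<open>Annihilators replace the ideals generated by f and g, so that no sums of products have
  to be handled: I is the set of x with x R g = 0, and J the set of y with I R y = 0. Then f lies in
  I by hypothesis, g in J by the choice of I, and h = 1 gives I J = 0.\<close>

lemma annihilating_ideals:
  assumes "f \<in> carrier R" "g \<in> carrier R" "\<And>h. h \<in> carrier R \<Longrightarrow> f \<otimes> h \<otimes> g = \<zero>"
  obtains I J where "ideal I R" "ideal J R" "f \<in> I" "g \<in> J" "\<And>x y. \<lbrakk>x \<in> I; y \<in> J\<rbrakk> \<Longrightarrow> x \<otimes> y = \<zero>"
proof -
  define I where "I = {x \<in> carrier R. \<forall>h\<in>carrier R. \<forall>y\<in>{g}. x \<otimes> h \<otimes> y = \<zero>}"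
  define J where "J = {y \<in> carrier R. \<forall>h\<in>carrier R. \<forall>x\<in>I. x \<otimes> h \<otimes> y = \<zero>}"
  have I: "I \<subseteq> carrier R" and J: "J \<subseteq> carrier R" by (auto simp: I_def J_def)
  show thesis
  proof (rule that)
    show "ideal I R" unfolding I_def using assms(2) by (intro ideal_left_annihilator) simp
    show "ideal J R" unfolding J_def using I by (rule ideal_right_annihilator)
    show "f \<in> I" using assms(1,3) by (simp add: I_def)
    show "g \<in> J" using assms(2) by (simp add: I_def J_def)
    fix x y assume xy: "x \<in> I" "y \<in> J"
    then have "x \<otimes> \<one> \<otimes> y = \<zero>" unfolding J_def using one_closed by blast
    then show "x \<otimes> y = \<zero>" using xy I by auto
  qed
qed

end

text \<open>Given f R g = 0, the annihilating ideals have zero product and contain f and g.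
  Conversely, if I J = 0 then (f h) g = 0 for f in I, g in J and every h, because f h lies in
  I.\<close>

lemma prime_ring_iff:
  "prime_ring R \<longleftrightarrow> ring R \<and> \<one>\<^bsub>R\<^esub> \<noteq> \<zero>\<^bsub>R\<^esub> \<and>
    (\<forall>f\<in>carrier R. \<forall>g\<in>carrier R. (\<forall>h\<in>carrier R. f \<otimes>\<^bsub>R\<^esub> h \<otimes>\<^bsub>R\<^esub> g = \<zero>\<^bsub>R\<^esub>) \<longrightarrow>
      f = \<zero>\<^bsub>R\<^esub> \<or> g = \<zero>\<^bsub>R\<^esub>)" (is "_ \<longleftrightarrow> _ \<and> _ \<and> ?E")
proof (intro iffI conjI)
  assume "prime_ring R"
  then interpret prime_ring R .
  show "ring R" by (rule ring_axioms)
  show "\<one>\<^bsub>R\<^esub> \<noteq> \<zero>\<^bsub>R\<^esub>" by (rule one_not_zero)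
  show ?E
  proof (intro ballI impI)
    fix f g assume "f \<in> carrier R" "g \<in> carrier R" "\<forall>h\<in>carrier R. f \<otimes>\<^bsub>R\<^esub> h \<otimes>\<^bsub>R\<^esub> g = \<zero>\<^bsub>R\<^esub>"
    then obtain I J where "ideal I R" "ideal J R" "f \<in> I" "g \<in> J"
      "\<And>x y. \<lbrakk>x \<in> I; y \<in> J\<rbrakk> \<Longrightarrow> x \<otimes>\<^bsub>R\<^esub> y = \<zero>\<^bsub>R\<^esub>"
      using annihilating_ideals[of f g] by blast
    then show "f = \<zero>\<^bsub>R\<^esub> \<or> g = \<zero>\<^bsub>R\<^esub>"
      using prime ideal_prod_eq_zeroI by blast
  qed
next
  assume *: "ring R \<and> \<one>\<^bsub>R\<^esub> \<noteq> \<zero>\<^bsub>R\<^esub> \<and> ?E"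
  then interpret ring R by blast
  show "prime_ring R"
  proof
    show "\<one>\<^bsub>R\<^esub> \<noteq> \<zero>\<^bsub>R\<^esub>" using * by blast
    fix I J assume I: "ideal I R" and J: "ideal J R" and IJ: "ideal_prod R I J = {\<zero>\<^bsub>R\<^esub>}"
    have zero: "\<zero>\<^bsub>R\<^esub> \<in> I" "\<zero>\<^bsub>R\<^esub> \<in> J"
      using I J by (simp_all add: additive_subgroup.zero_closed ideal.axioms(1))
    have "f = \<zero>\<^bsub>R\<^esub> \<or> g = \<zero>\<^bsub>R\<^esub>" if "f \<in> I" "g \<in> J" for f g
    proof -
      have "f \<otimes>\<^bsub>R\<^esub> h \<otimes>\<^bsub>R\<^esub> g = \<zero>\<^bsub>R\<^esub>" if "h \<in> carrier R" for h
        using ideal_prod.prod[OF ideal.I_r_closed[OF I \<open>f \<in> I\<close> that] \<open>g \<in> J\<close>, of R] IJ by simp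
      then show ?thesis
        using conjunct2[OF conjunct2[OF *]] ideal.Icarr[OF I that(1)] ideal.Icarr[OF J that(2)] by simp
    qed
    then show "I = {\<zero>\<^bsub>R\<^esub>} \<or> J = {\<zero>\<^bsub>R\<^esub>}" using zero by blast
  qed
qed

lemma semiprime_ring_iff:
  "semiprime_ring R \<longleftrightarrow> ring R \<and>
    (\<forall>f\<in>carrier R. (\<forall>h\<in>carrier R. f \<otimes>\<^bsub>R\<^esub> h \<otimes>\<^bsub>R\<^esub> f = \<zero>\<^bsub>R\<^esub>) \<longrightarrow> f = \<zero>\<^bsub>R\<^esub>)" (is "_ \<longleftrightarrow> _ \<and> ?E")
proof (intro iffI conjI)
  assume "semiprime_ring R"
  then interpret semiprime_ring R .
  show "ring R" by (rule ring_axioms)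
  show ?E
  proof (intro ballI impI)
    fix f assume "f \<in> carrier R" "\<forall>h\<in>carrier R. f \<otimes>\<^bsub>R\<^esub> h \<otimes>\<^bsub>R\<^esub> f = \<zero>\<^bsub>R\<^esub>"
    then obtain I J where IJ: "ideal I R" "ideal J R" "f \<in> I" "f \<in> J"
      "\<And>x y. \<lbrakk>x \<in> I; y \<in> J\<rbrakk> \<Longrightarrow> x \<otimes>\<^bsub>R\<^esub> y = \<zero>\<^bsub>R\<^esub>"
      using annihilating_ideals[of f f] by blast
    \<comment> \<open>The two annihilating ideals may differ; their intersection contains f and has
      zero square.\<close>
    have id: "ideal (I \<inter> J) R" using IJ(1,2) by (rule i_intersect)
    have "ideal_prod R (I \<inter> J) (I \<inter> J) = {\<zero>\<^bsub>R\<^esub>}"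
      using IJ(5) by (intro ideal_prod_eq_zeroI[OF id id]) auto
    then have "I \<inter> J = {\<zero>\<^bsub>R\<^esub>}" by (rule semiprime[OF id])
    then show "f = \<zero>\<^bsub>R\<^esub>" using IJ by blast
  qed
next
  assume *: "ring R \<and> ?E"
  then interpret ring R by blast
  show "semiprime_ring R"
  proof
    fix I assume I: "ideal I R" and II: "ideal_prod R I I = {\<zero>\<^bsub>R\<^esub>}"
    have "\<zero>\<^bsub>R\<^esub> \<in> I"
      using I by (simp add: additive_subgroup.zero_closed ideal.axioms(1))
    moreover have "f = \<zero>\<^bsub>R\<^esub>" if "f \<in> I" for f
    proof -
      have "f \<otimes>\<^bsub>R\<^esub> h \<otimes>\<^bsub>R\<^esub> f = \<zero>\<^bsub>R\<^esub>" if "h \<in> carrier R" for h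
        using ideal_prod.prod[OF ideal.I_r_closed[OF I \<open>f \<in> I\<close> that] \<open>f \<in> I\<close>, of R] II by simp
      then show ?thesis using conjunct2[OF *] ideal.Icarr[OF I that] by simp
    qed
    ultimately show "I = {\<zero>\<^bsub>R\<^esub>}" by blast
  qed
qed

lemma reduced_ring_iff:
  "reduced_ring R \<longleftrightarrow> ring R \<and> (\<forall>f\<in>carrier R. f \<otimes>\<^bsub>R\<^esub> f = \<zero>\<^bsub>R\<^esub> \<longrightarrow> f = \<zero>\<^bsub>R\<^esub>)"
proof (intro iffI conjI ballI impI)
  assume "reduced_ring R"
  then interpret reduced_ring R .
  show "ring R" by (rule ring_axioms)
  fix f assume "f \<in> carrier R" "f \<otimes>\<^bsub>R\<^esub> f = \<zero>\<^bsub>R\<^esub>"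
  then show "f = \<zero>\<^bsub>R\<^esub>" using reduced[of f 2] by (simp add: numeral_2_eq_2)
next
  assume *: "ring R \<and> (\<forall>f\<in>carrier R. f \<otimes>\<^bsub>R\<^esub> f = \<zero>\<^bsub>R\<^esub> \<longrightarrow> f = \<zero>\<^bsub>R\<^esub>)"
  then interpret ring R by blast
  show "reduced_ring R"
  proof
    fix a and n :: nat
    assume a: "a \<in> carrier R"
    show "a [^]\<^bsub>R\<^esub> n = \<zero>\<^bsub>R\<^esub> \<Longrightarrow> a = \<zero>\<^bsub>R\<^esub>"
    proof (induction n)
      \<comment> \<open>A vanishing zeroth power says that 1 = 0, and then every element is
        zero.\<close>
      case 0
      then have "\<one>\<^bsub>R\<^esub> = \<zero>\<^bsub>R\<^esub>" by simp
      then show ?case using a by (metis l_one l_null)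
    next
      case (Suc n)
      show ?case
      proof (cases n)
        case 0
        then show ?thesis using Suc.prems a by simp
      next
        case (Suc m)
        \<comment> \<open>With n = m + 1 the exponents satisfy n + n = (n + 1) + m, so the vanishing
          (n + 1)-st power makes the n-th power square to zero. It is therefore zero, which is the
          premise of the induction hypothesis.\<close>
        have "a [^]\<^bsub>R\<^esub> n \<otimes>\<^bsub>R\<^esub> a [^]\<^bsub>R\<^esub> n = a [^]\<^bsub>R\<^esub> (Suc n + m)"
          using a Suc by (subst nat_pow_mult) simp_all
        also have "\<dots> = a [^]\<^bsub>R\<^esub> Suc n \<otimes>\<^bsub>R\<^esub> a [^]\<^bsub>R\<^esub> m"
          using a by (simp only: nat_pow_mult)
        also have "\<dots> = \<zero>\<^bsub>R\<^esub>" using Suc.prems a by simp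
        finally have "a [^]\<^bsub>R\<^esub> n = \<zero>\<^bsub>R\<^esub>"
          by (rule conjunct2[OF *, rule_format, OF nat_pow_closed[OF a]])
        then show ?thesis by (rule Suc.IH)
      qed
    qed
  qed
qed

section \<open>Prime, semiprime, reduced and integral dual rings\<close>

context coring
begin

interpretation D: ring D
  by (rule ring_dual_ring)

lemma harpoon_zero_left: "dual s \<Longrightarrow> harpoon C \<zero>\<^bsub>C\<^esub> s = \<zero>\<^bsub>C\<^esub>"
  using additive_map_zero[OF right_linear_additive[OF harpoon_right_linear] C_group C_group] .

lemma harpoon_zero_right:
  assumes "c \<in> carrier C"
  shows "harpoon C c \<zero>\<^bsub>D\<^esub> = \<zero>\<^bsub>C\<^esub>"
  using harpoon_dual_ring_add[OF D.zero_closed D.zero_closed assms]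
    harpoon_closed[OF dual_ringD[OF D.zero_closed] assms]
  by (simp add: C.M.add.r_cancel_one')

text \<open>Faithfulness of the action, from f(c) = \<epsilon>(c f).\<close>

lemma dual_ring_eq_zero_iff:
  assumes f: "f \<in> carrier D"
  shows "f = \<zero>\<^bsub>D\<^esub> \<longleftrightarrow> (\<forall>c\<in>carrier C. harpoon C c f = \<zero>\<^bsub>C\<^esub>)"
proof
  assume *: "\<forall>c\<in>carrier C. harpoon C c f = \<zero>\<^bsub>C\<^esub>"
  have e: "counit C \<zero>\<^bsub>C\<^esub> = \<zero>\<^bsub>A\<^esub>"
    using additive_map_zero[of C A "counit C"] dual_closed[OF dual_counit] dual_add[OF dual_counit]
      C_group C.A.abelian_group_axioms by (simp add: additive_map_def)
  show "f = \<zero>\<^bsub>D\<^esub>"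
    using counit_harpoon[OF dual_ringD[OF f]] * e
    by (intro dual_ring_eqI[OF f D.zero_closed]) (simp add: dual_ring_apply)
qed (simp add: harpoon_zero_right)

text \<open>Here C \<noteq> 0 enters: 1 = 0 would give c = c 1 = c 0 = 0 for all c.\<close>

lemma dual_ring_one_not_zero:
  assumes "carrier C \<noteq> {\<zero>\<^bsub>C\<^esub>}"
  shows "\<one>\<^bsub>D\<^esub> \<noteq> \<zero>\<^bsub>D\<^esub>"
proof
  assume "\<one>\<^bsub>D\<^esub> = \<zero>\<^bsub>D\<^esub>"
  then have "c = \<zero>\<^bsub>C\<^esub>" if "c \<in> carrier C" for c
    using harpoon_one[OF that] harpoon_zero_right[OF that] by simp
  then show False using assms C.M.zero_closed by blast
qed

section \<open>Functionals that annihilate C S\<close>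

text \<open>On a generator (c t) s = c (t s) = 0, and x \<mapsto> x s is additive.\<close>

lemma act_set_harpoon_zero:
  assumes S: "S \<subseteq> carrier D" and s: "s \<in> carrier D"
    and zero: "\<And>t. t \<in> S \<Longrightarrow> t \<otimes>\<^bsub>D\<^esub> s = \<zero>\<^bsub>D\<^esub>" and x: "x \<in> act_set C S"
  shows "harpoon C x s = \<zero>\<^bsub>C\<^esub>"
proof (rule additive_map_generate_eq[OF C_group C_group act_set_gen_closed, of S "C\<lparr>carrier := act_set C S\<rparr>"
      "\<lambda>x. harpoon C x s" "\<lambda>_. \<zero>\<^bsub>C\<^esub>"])
  have S': "dual t" if "t \<in> S" for t using S that dual_ringD by blast
  then show "\<And>t. t \<in> S \<Longrightarrow> dual t" .
  have inC: "y \<in> act_set C S \<Longrightarrow> y \<in> carrier C" for y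
    using subgroup.mem_carrier[OF act_set_subgroup[of S, OF S']] by simp
  show "additive_map (C\<lparr>carrier := act_set C S\<rparr>) C (\<lambda>x. harpoon C x s)"
    using dual_ringD[OF s] by (intro additive_mapI) (simp_all add: inC harpoon_closed harpoon_add)
  show "additive_map (C\<lparr>carrier := act_set C S\<rparr>) C (\<lambda>x. \<zero>\<^bsub>C\<^esub>)"
    by (intro additive_mapI) simp_all
  show "harpoon C y s = \<zero>\<^bsub>C\<^esub>" if "y \<in> {harpoon C c t |c t. c \<in> carrier C \<and> t \<in> S}" for y
    using that zero S s by (auto simp: harpoon_harpoon S' dual_ringD harpoon_zero_right)
qed (use x in \<open>simp_all add: act_set_def\<close>)

lemma act_set_subset:
  assumes "S \<subseteq> carrier D" "T \<subseteq> carrier D"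
    and "\<And>c s. \<lbrakk>c \<in> carrier C; s \<in> S\<rbrakk> \<Longrightarrow> harpoon C c s \<in> act_set C T"
  shows "act_set C S \<subseteq> act_set C T"
proof -
  have "subgroup (act_set C T) (add_monoid C)"
    using assms(2) dual_ringD by (intro act_set_subgroup) blast
  then show ?thesis
    unfolding act_set_def[of C S] using assms(3)
    by (intro group.generate_subgroup_incl[OF C.M.a_group]) auto
qed

lemma act_set_zero:
  assumes "S \<subseteq> {\<zero>\<^bsub>D\<^esub>}"
  shows "act_set C S \<subseteq> {\<zero>\<^bsub>C\<^esub>}"
  unfolding act_set_def
proof (rule group.generate_subgroup_incl[OF C.M.a_group])
  show "subgroup {\<zero>\<^bsub>C\<^esub>} (add_monoid C)"
    using group.triv_subgroup[OF C.M.a_group] by simp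
qed (use assms harpoon_zero_right in auto)

text \<open>Every c t with t in S lies in the zero coset, so (c t) s is the value of h there, namely
  0 s = 0. Thus t s acts as zero, and faithfulness gives t s = 0.\<close>

lemma factor_hom_annihilates:
  assumes flat: "flat_left_module A C" and S: "S \<subseteq> carrier D"
    and h: "h \<in> comod_Hom A C (factor_comodule A C (coring_comod C) (act_set C S)) (coring_comod C)"
  obtains s where "s \<in> carrier D" "\<And>t. t \<in> S \<Longrightarrow> t \<otimes>\<^bsub>D\<^esub> s = \<zero>\<^bsub>D\<^esub>"
    "\<And>c. c \<in> carrier C \<Longrightarrow> h (act_set C S +>\<^bsub>C\<^esub> c) = harpoon C c s"
proof -
  have S': "dual t" if "t \<in> S" for t using S that dual_ringD by blast
  note sub = act_set_subgroup[of S, OF S']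
  obtain s where s: "s \<in> carrier D"
    and hs: "\<And>c. c \<in> carrier C \<Longrightarrow> h (act_set C S +>\<^bsub>C\<^esub> c) = harpoon C c s"
    using factor_comodule_hom_harpoon[OF subcomodule_act_set[OF flat S'] h] by blast
  have "t \<otimes>\<^bsub>D\<^esub> s = \<zero>\<^bsub>D\<^esub>" if t: "t \<in> S" for t
  proof -
    have "harpoon C c (t \<otimes>\<^bsub>D\<^esub> s) = \<zero>\<^bsub>C\<^esub>" if c: "c \<in> carrier C" for c
    proof -
      have tc: "harpoon C c t \<in> act_set C S" "harpoon C c t \<in> carrier C"
        using act_set_incl[OF c t] harpoon_closed[OF S'[OF t] c] by auto
      have "act_set C S +>\<^bsub>C\<^esub> harpoon C c t = act_set C S +>\<^bsub>C\<^esub> \<zero>\<^bsub>C\<^esub>"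
        using C.M.a_coset_join2[OF tc(2) sub tc(1)] C.M.a_coset_join2[OF C.M.zero_closed sub]
          subgroup.one_closed[OF sub] by simp
      then have "harpoon C (harpoon C c t) s = harpoon C \<zero>\<^bsub>C\<^esub> s"
        using hs[OF tc(2)] hs[OF C.M.zero_closed] by simp
      then show ?thesis
        using harpoon_harpoon[OF S'[OF t] dual_ringD[OF s] c] harpoon_zero_left[OF dual_ringD[OF s]] by simp
    qed
    then show ?thesis using S t s dual_ring_eq_zero_iff[of "t \<otimes>\<^bsub>D\<^esub> s"] by blast
  qed
  then show thesis using that s hs by blast
qed

lemma coset_coring_comod: "K +>\<^bsub>coring_comod C\<^esub> x = K +>\<^bsub>C\<^esub> x"
  by (simp add: a_r_coset_def')

lemma coretractable_annihilator:
  assumes flat: "flat_left_module A C" and S: "S \<subseteq> carrier D"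
    and "coretractable A C (coring_comod C)" and "carrier C \<noteq> act_set C S"
  obtains s where "s \<in> carrier D" "s \<noteq> \<zero>\<^bsub>D\<^esub>" "\<And>t. t \<in> S \<Longrightarrow> t \<otimes>\<^bsub>D\<^esub> s = \<zero>\<^bsub>D\<^esub>"
proof -
  have "subcomodule A C (coring_comod C) (act_set C S)"
    using S dual_ringD by (intro subcomodule_act_set[OF flat]) blast
  then obtain h X where h: "h \<in> comod_Hom A C (factor_comodule A C (coring_comod C) (act_set C S)) (coring_comod C)"
    and X: "X \<in> a_rcosets\<^bsub>coring_comod C\<^esub> (act_set C S)" "h X \<noteq> \<zero>\<^bsub>C\<^esub>"
    using assms(3,4) unfolding coretractable_def by fastforce
  obtain c where c: "c \<in> carrier C" "X = act_set C S +>\<^bsub>C\<^esub> c"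
    using X(1) by (auto simp: A_RCOSETS_def' coset_coring_comod)
  obtain s where s: "s \<in> carrier D" "\<And>t. t \<in> S \<Longrightarrow> t \<otimes>\<^bsub>D\<^esub> s = \<zero>\<^bsub>D\<^esub>"
    "\<And>c. c \<in> carrier C \<Longrightarrow> h (act_set C S +>\<^bsub>C\<^esub> c) = harpoon C c s"
    using factor_hom_annihilates[OF flat S h] by blast
  then show thesis
    using that[of s] c X(2) harpoon_zero_right by auto
qed

lemma self_cogenerator_annihilator:
  assumes flat: "flat_left_module A C" and S: "S \<subseteq> carrier D"
    and cogen: "self_cogenerator A C (coring_comod C)" and x: "x \<in> carrier C" "x \<notin> act_set C S"
  obtains s where "s \<in> carrier D" "harpoon C x s \<noteq> \<zero>\<^bsub>C\<^esub>" "\<And>t. t \<in> S \<Longrightarrow> t \<otimes>\<^bsub>D\<^esub> s = \<zero>\<^bsub>D\<^esub>"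
proof -
  let ?K = "act_set C S"
  have S': "dual t" if "t \<in> S" for t using S that dual_ringD by blast
  note sub = act_set_subgroup[of S, OF S']
  have "x \<in> ?K +>\<^bsub>C\<^esub> x"
    using C.M.add.rcos_self[OF _ sub] x(1) by (simp add: a_r_coset_def)
  then have "?K +>\<^bsub>C\<^esub> x \<noteq> ?K" using x(2) by blast
  moreover have "?K +>\<^bsub>C\<^esub> x \<in> a_rcosets\<^bsub>coring_comod C\<^esub> ?K"
    using x(1) by (auto simp: A_RCOSETS_def' coset_coring_comod)
  moreover have "{X \<in> a_rcosets\<^bsub>coring_comod C\<^esub> ?K.
      \<forall>h\<in>comod_Hom A C (factor_comodule A C (coring_comod C) ?K) (coring_comod C). h X = \<zero>\<^bsub>C\<^esub>} = {?K}"
    using cogen subcomodule_act_set[OF flat S'] unfolding self_cogenerator_def by auto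
  ultimately obtain h where h: "h \<in> comod_Hom A C (factor_comodule A C (coring_comod C) ?K) (coring_comod C)"
    and hx: "h (?K +>\<^bsub>C\<^esub> x) \<noteq> \<zero>\<^bsub>C\<^esub>"
    by blast
  obtain s where "s \<in> carrier D" "\<And>t. t \<in> S \<Longrightarrow> t \<otimes>\<^bsub>D\<^esub> s = \<zero>\<^bsub>D\<^esub>"
    "\<And>c. c \<in> carrier C \<Longrightarrow> h (act_set C S +>\<^bsub>C\<^esub> c) = harpoon C c s"
    using factor_hom_annihilates[OF flat S h] by blast
  then show thesis using that[of s] hx x(1) by auto
qed

lemma l_coset_dual_ring: "f <#\<^bsub>D\<^esub> carrier D = {f \<otimes>\<^bsub>D\<^esub> h | h. h \<in> carrier D}"
  by (auto simp: l_coset_def)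

lemma lr_coset_dual_ring:
  "(f <#\<^bsub>D\<^esub> carrier D) #>\<^bsub>D\<^esub> f = {f \<otimes>\<^bsub>D\<^esub> h \<otimes>\<^bsub>D\<^esub> f | h. h \<in> carrier D}"
  by (auto simp: l_coset_def r_coset_def)

section \<open>Sufficient conditions\<close>

text \<open>If f \<noteq> 0 and f D g = 0, then g kills C (f D), which is all of C; by faithfulness
  g = 0.\<close>

lemma dual_ring_primeI:
  assumes "carrier C \<noteq> {\<zero>\<^bsub>C\<^esub>}"
    and gen: "\<And>f. f \<in> carrier D - {\<zero>\<^bsub>D\<^esub>} \<Longrightarrow> carrier C = act_set C (f <#\<^bsub>D\<^esub> carrier D)"
  shows "prime_ring D"
  unfolding prime_ring_iff
proof (intro conjI ballI impI D.ring_axioms dual_ring_one_not_zero[OF assms(1)])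
  fix f g assume f: "f \<in> carrier D" and g: "g \<in> carrier D"
    and fhg: "\<forall>h\<in>carrier D. f \<otimes>\<^bsub>D\<^esub> h \<otimes>\<^bsub>D\<^esub> g = \<zero>\<^bsub>D\<^esub>"
  have "f <#\<^bsub>D\<^esub> carrier D \<subseteq> carrier D" "\<And>t. t \<in> f <#\<^bsub>D\<^esub> carrier D \<Longrightarrow> t \<otimes>\<^bsub>D\<^esub> g = \<zero>\<^bsub>D\<^esub>"
    using f fhg by (auto simp: l_coset_dual_ring)
  then have "g = \<zero>\<^bsub>D\<^esub>" if "f \<noteq> \<zero>\<^bsub>D\<^esub>"
    unfolding dual_ring_eq_zero_iff[OF g]
    using gen[of f] that f act_set_harpoon_zero[OF _ g] by blast
  then show "f = \<zero>\<^bsub>D\<^esub> \<or> g = \<zero>\<^bsub>D\<^esub>" by blast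
qed

lemma dual_ring_domainI:
  assumes "carrier C \<noteq> {\<zero>\<^bsub>C\<^esub>}"
    and gen: "\<And>f. f \<in> carrier D - {\<zero>\<^bsub>D\<^esub>} \<Longrightarrow> carrier C = act_set C {f}"
  shows "nc_domain D"
proof (intro nc_domain.intro nc_domain_axioms.intro D.ring_axioms dual_ring_one_not_zero[OF assms(1)])
  fix f g assume f: "f \<in> carrier D" and g: "g \<in> carrier D" and fg: "f \<otimes>\<^bsub>D\<^esub> g = \<zero>\<^bsub>D\<^esub>"
  have "g = \<zero>\<^bsub>D\<^esub>" if "f \<noteq> \<zero>\<^bsub>D\<^esub>"
    unfolding dual_ring_eq_zero_iff[OF g]
    using gen[of f] that f g fg act_set_harpoon_zero[of "{f}" g] by auto
  then show "f = \<zero>\<^bsub>D\<^esub> \<or> g = \<zero>\<^bsub>D\<^esub>" by blast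
qed

text \<open>Shared by the semiprime and reduced cases: there f D f or f f vanishes, so C f = 0 by
  the assumed equality, and f = 0 by faithfulness.\<close>

lemma act_set_eq_zero:
  assumes f: "f \<in> carrier D" and "act_set C {f} = act_set C S" "S \<subseteq> {\<zero>\<^bsub>D\<^esub>}"
  shows "f = \<zero>\<^bsub>D\<^esub>"
  unfolding dual_ring_eq_zero_iff[OF f]
  using act_set_incl[of _ f "{f}"] assms(2) act_set_zero[OF assms(3)] by blast

lemma dual_ring_semiprimeI:
  assumes gen: "\<And>f. f \<in> carrier D - {\<zero>\<^bsub>D\<^esub>} \<Longrightarrow>
      act_set C {f} = act_set C ((f <#\<^bsub>D\<^esub> carrier D) #>\<^bsub>D\<^esub> f)"
  shows "semiprime_ring D"
  unfolding semiprime_ring_iff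
proof (intro conjI ballI impI D.ring_axioms)
  fix f assume f: "f \<in> carrier D" and "\<forall>h\<in>carrier D. f \<otimes>\<^bsub>D\<^esub> h \<otimes>\<^bsub>D\<^esub> f = \<zero>\<^bsub>D\<^esub>"
  then have "(f <#\<^bsub>D\<^esub> carrier D) #>\<^bsub>D\<^esub> f \<subseteq> {\<zero>\<^bsub>D\<^esub>}" by (auto simp: lr_coset_dual_ring)
  then show "f = \<zero>\<^bsub>D\<^esub>" using act_set_eq_zero[OF f gen] f by blast
qed

lemma dual_ring_reducedI:
  assumes gen: "\<And>f. f \<in> carrier D - {\<zero>\<^bsub>D\<^esub>} \<Longrightarrow> act_set C {f} = act_set C {f \<otimes>\<^bsub>D\<^esub> f}"
  shows "reduced_ring D"
  unfolding reduced_ring_iff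
proof (intro conjI ballI impI D.ring_axioms)
  fix f assume f: "f \<in> carrier D" and "f \<otimes>\<^bsub>D\<^esub> f = \<zero>\<^bsub>D\<^esub>"
  then show "f = \<zero>\<^bsub>D\<^esub>" using act_set_eq_zero[OF f gen] f by blast
qed

section \<open>Necessary conditions\<close>

text \<open>If C (f D) were proper, the nonzero s supplied by coretractability would satisfy (f D) s
  = 0, contradicting the elementwise form of primeness for f and s.\<close>

lemma prime_act_set:
  assumes flat: "flat_left_module A C" and cr: "coretractable A C (coring_comod C)"
    and prime: "prime_ring D" and f: "f \<in> carrier D - {\<zero>\<^bsub>D\<^esub>}"
  shows "carrier C = act_set C (f <#\<^bsub>D\<^esub> carrier D)"
proof (rule ccontr)
  assume "carrier C \<noteq> act_set C (f <#\<^bsub>D\<^esub> carrier D)"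
  then obtain s where s: "s \<in> carrier D" "s \<noteq> \<zero>\<^bsub>D\<^esub>"
    "\<And>t. t \<in> f <#\<^bsub>D\<^esub> carrier D \<Longrightarrow> t \<otimes>\<^bsub>D\<^esub> s = \<zero>\<^bsub>D\<^esub>"
    using f by (elim coretractable_annihilator[OF flat _ cr, rotated]) (auto simp: l_coset_dual_ring)
  then have "\<forall>h\<in>carrier D. f \<otimes>\<^bsub>D\<^esub> h \<otimes>\<^bsub>D\<^esub> s = \<zero>\<^bsub>D\<^esub>" by (auto simp: l_coset_dual_ring)
  then show False using prime f s unfolding prime_ring_iff by blast
qed

lemma domain_act_set:
  assumes flat: "flat_left_module A C" and cr: "coretractable A C (coring_comod C)"
    and dom: "nc_domain D" and f: "f \<in> carrier D - {\<zero>\<^bsub>D\<^esub>}"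
  shows "carrier C = act_set C {f}"
proof (rule ccontr)
  assume "carrier C \<noteq> act_set C {f}"
  then obtain s where "s \<in> carrier D" "s \<noteq> \<zero>\<^bsub>D\<^esub>" "\<And>t. t \<in> {f} \<Longrightarrow> t \<otimes>\<^bsub>D\<^esub> s = \<zero>\<^bsub>D\<^esub>"
    using f by (elim coretractable_annihilator[OF flat _ cr, rotated]) auto
  then show False using nc_domain.integral[OF dom, of f s] f by blast
qed

text \<open>If c f lies outside C (f D f), some s satisfies (c f) s \<noteq> 0 and (f D f) s = 0.
  Then f s \<noteq> 0, but (f s) D (f s) is contained in (f D f) s = 0, contradicting semiprimeness.
  The reverse inclusion is c (f h f) = (c (f h)) f.\<close>

lemma semiprime_act_set:
  assumes flat: "flat_left_module A C" and cogen: "self_cogenerator A C (coring_comod C)"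
    and semiprime: "semiprime_ring D" and f: "f \<in> carrier D"
  shows "act_set C {f} = act_set C ((f <#\<^bsub>D\<^esub> carrier D) #>\<^bsub>D\<^esub> f)" (is "_ = act_set C ?S")
proof
  have S: "?S \<subseteq> carrier D" using f by (auto simp: lr_coset_dual_ring)
  show "act_set C {f} \<subseteq> act_set C ?S"
  proof (rule act_set_subset[OF _ S])
    fix c g assume c: "c \<in> carrier C" and g: "g \<in> {f}"
    show "harpoon C c g \<in> act_set C ?S"
    proof (rule ccontr)
      assume "harpoon C c g \<notin> act_set C ?S"
      then have "harpoon C c f \<notin> act_set C ?S" using g by simp
      then obtain s where s: "s \<in> carrier D" "harpoon C (harpoon C c f) s \<noteq> \<zero>\<^bsub>C\<^esub>"
        and Ss: "\<And>t. t \<in> ?S \<Longrightarrow> t \<otimes>\<^bsub>D\<^esub> s = \<zero>\<^bsub>D\<^esub>"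
        using self_cogenerator_annihilator[OF flat S cogen harpoon_closed[OF dual_ringD[OF f] c]]
        by metis
      have "f \<otimes>\<^bsub>D\<^esub> s \<noteq> \<zero>\<^bsub>D\<^esub>"
        using s c f by (auto simp: harpoon_harpoon dual_ringD harpoon_zero_right)
      moreover have "(f \<otimes>\<^bsub>D\<^esub> s) \<otimes>\<^bsub>D\<^esub> h \<otimes>\<^bsub>D\<^esub> (f \<otimes>\<^bsub>D\<^esub> s) = \<zero>\<^bsub>D\<^esub>" if h: "h \<in> carrier D" for h
      proof -
        have "(f \<otimes>\<^bsub>D\<^esub> s) \<otimes>\<^bsub>D\<^esub> h \<otimes>\<^bsub>D\<^esub> (f \<otimes>\<^bsub>D\<^esub> s) = f \<otimes>\<^bsub>D\<^esub> (s \<otimes>\<^bsub>D\<^esub> h) \<otimes>\<^bsub>D\<^esub> f \<otimes>\<^bsub>D\<^esub> s"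
          using f s(1) h by (simp add: D.m_assoc)
        moreover have "f \<otimes>\<^bsub>D\<^esub> (s \<otimes>\<^bsub>D\<^esub> h) \<otimes>\<^bsub>D\<^esub> f \<in> ?S"
          unfolding lr_coset_dual_ring using D.m_closed[OF s(1) h] by blast
        then have "f \<otimes>\<^bsub>D\<^esub> (s \<otimes>\<^bsub>D\<^esub> h) \<otimes>\<^bsub>D\<^esub> f \<otimes>\<^bsub>D\<^esub> s = \<zero>\<^bsub>D\<^esub>" by (rule Ss)
        ultimately show ?thesis by simp
      qed
      ultimately show False
        using semiprime f s(1) unfolding semiprime_ring_iff by blast
    qed
  qed (use f in simp)
  show "act_set C ?S \<subseteq> act_set C {f}"
  proof (rule act_set_subset[OF S])
    fix c s assume c: "c \<in> carrier C" and "s \<in> ?S"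
    then obtain h where h: "h \<in> carrier D" "s = f \<otimes>\<^bsub>D\<^esub> h \<otimes>\<^bsub>D\<^esub> f"
      by (auto simp: lr_coset_dual_ring)
    have "harpoon C c s = harpoon C (harpoon C c (f \<otimes>\<^bsub>D\<^esub> h)) f"
      using c f h by (simp add: harpoon_harpoon dual_ringD)
    then show "harpoon C c s \<in> act_set C {f}"
      using c f h by (simp add: act_set_incl harpoon_closed dual_ringD)
  qed (use f in simp)
qed

text \<open>Now s satisfies (c f) s \<noteq> 0 and f f s = 0. Reducedness is used twice: (f s f) (f
  s f) contains the factor f f s, so f s f = 0; then (f s) (f s) = (f s f) s = 0, so f s = 0,
  contradicting (c f) s \<noteq> 0.\<close>

lemma reduced_act_set:
  assumes flat: "flat_left_module A C" and cogen: "self_cogenerator A C (coring_comod C)"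
    and reduced: "reduced_ring D" and f: "f \<in> carrier D"
  shows "act_set C {f} = act_set C {f \<otimes>\<^bsub>D\<^esub> f}"
proof
  have S: "{f \<otimes>\<^bsub>D\<^esub> f} \<subseteq> carrier D" using f by simp
  have square: "g = \<zero>\<^bsub>D\<^esub>" if "g \<in> carrier D" "g \<otimes>\<^bsub>D\<^esub> g = \<zero>\<^bsub>D\<^esub>" for g
    using reduced that unfolding reduced_ring_iff by blast
  show "act_set C {f} \<subseteq> act_set C {f \<otimes>\<^bsub>D\<^esub> f}"
  proof (rule act_set_subset[OF _ S])
    fix c g assume c: "c \<in> carrier C" and g: "g \<in> {f}"
    show "harpoon C c g \<in> act_set C {f \<otimes>\<^bsub>D\<^esub> f}"
    proof (rule ccontr)
      assume "harpoon C c g \<notin> act_set C {f \<otimes>\<^bsub>D\<^esub> f}"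
      then have "harpoon C c f \<notin> act_set C {f \<otimes>\<^bsub>D\<^esub> f}" using g by simp
      then obtain s where s: "s \<in> carrier D" "harpoon C (harpoon C c f) s \<noteq> \<zero>\<^bsub>C\<^esub>"
        and Ss: "\<And>t. t \<in> {f \<otimes>\<^bsub>D\<^esub> f} \<Longrightarrow> t \<otimes>\<^bsub>D\<^esub> s = \<zero>\<^bsub>D\<^esub>"
        using self_cogenerator_annihilator[OF flat S cogen harpoon_closed[OF dual_ringD[OF f] c]]
        by metis
      \<comment> \<open>The factor y is carried along because the square of f s f, after
        reassociation to the right, ends in s f.\<close>
      have ffs: "f \<otimes>\<^bsub>D\<^esub> (f \<otimes>\<^bsub>D\<^esub> x) = \<zero>\<^bsub>D\<^esub>" if "x = s \<otimes>\<^bsub>D\<^esub> y" "y \<in> carrier D" for x y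
        using Ss[of "f \<otimes>\<^bsub>D\<^esub> f"] that f s(1) by (simp flip: D.m_assoc)
      have "(f \<otimes>\<^bsub>D\<^esub> s \<otimes>\<^bsub>D\<^esub> f) \<otimes>\<^bsub>D\<^esub> (f \<otimes>\<^bsub>D\<^esub> s \<otimes>\<^bsub>D\<^esub> f) = f \<otimes>\<^bsub>D\<^esub> s \<otimes>\<^bsub>D\<^esub> (f \<otimes>\<^bsub>D\<^esub> (f \<otimes>\<^bsub>D\<^esub> (s \<otimes>\<^bsub>D\<^esub> f)))"
        using f s(1) by (simp add: D.m_assoc)
      also have "\<dots> = \<zero>\<^bsub>D\<^esub>" using f s(1) ffs[of _ f] by simp
      finally have fsf: "f \<otimes>\<^bsub>D\<^esub> s \<otimes>\<^bsub>D\<^esub> f = \<zero>\<^bsub>D\<^esub>"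
        by (rule square[OF D.m_closed[OF D.m_closed[OF f s(1)] f]])
      have "(f \<otimes>\<^bsub>D\<^esub> s) \<otimes>\<^bsub>D\<^esub> (f \<otimes>\<^bsub>D\<^esub> s) = f \<otimes>\<^bsub>D\<^esub> s \<otimes>\<^bsub>D\<^esub> f \<otimes>\<^bsub>D\<^esub> s"
        using f s(1) by (simp add: D.m_assoc)
      also have "\<dots> = \<zero>\<^bsub>D\<^esub>" using s(1) by (simp add: fsf)
      finally have "f \<otimes>\<^bsub>D\<^esub> s = \<zero>\<^bsub>D\<^esub>"
        by (rule square[OF D.m_closed[OF f s(1)]])
      then show False
        using s c f by (auto simp: harpoon_harpoon dual_ringD harpoon_zero_right)
    qed
  qed (use f in simp)
  show "act_set C {f \<otimes>\<^bsub>D\<^esub> f} \<subseteq> act_set C {f}"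
    using f by (intro act_set_subset)
      (auto simp: act_set_incl harpoon_closed dual_ringD simp flip: harpoon_harpoon)
qed

end

theorem theorem5p4:
  fixes R :: "('r, 'rx) ring_scheme"
    and A :: "('r, 'a, 'ax) module_scheme"
    and C :: "('a, 'c, 'cx) coring_scheme"
  assumes "unital_algebra R A" and "\<one>\<^bsub>R\<^esub> \<noteq> \<zero>\<^bsub>R\<^esub>"
    and "coring A C" and "carrier C \<noteq> {\<zero>\<^bsub>C\<^esub>}"
    and "flat_left_module A C"
  shows "let D = dual_ring A C in
    ((\<forall>f \<in> carrier D - {\<zero>\<^bsub>D\<^esub>}. carrier C = act_set C (f <#\<^bsub>D\<^esub> carrier D)) \<longrightarrow> prime_ring D) \<and>
    ((\<forall>f \<in> carrier D - {\<zero>\<^bsub>D\<^esub>}. carrier C = act_set C {f}) \<longrightarrow> nc_domain D) \<and>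
    (coretractable A C (coring_comod C) \<longrightarrow>
      (prime_ring D \<longleftrightarrow>
        (\<forall>f \<in> carrier D - {\<zero>\<^bsub>D\<^esub>}. carrier C = act_set C (f <#\<^bsub>D\<^esub> carrier D))) \<and>
      (nc_domain D \<longleftrightarrow>
        (\<forall>f \<in> carrier D - {\<zero>\<^bsub>D\<^esub>}. carrier C = act_set C {f}))) \<and>
    ((\<forall>f \<in> carrier D - {\<zero>\<^bsub>D\<^esub>}.
        act_set C {f} = act_set C ((f <#\<^bsub>D\<^esub> carrier D) #>\<^bsub>D\<^esub> f)) \<longrightarrow> semiprime_ring D) \<and>
    ((\<forall>f \<in> carrier D - {\<zero>\<^bsub>D\<^esub>}.
        act_set C {f} = act_set C {f \<otimes>\<^bsub>D\<^esub> f}) \<longrightarrow> reduced_ring D) \<and>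
    (self_cogenerator A C (coring_comod C) \<longrightarrow>
      (semiprime_ring D \<longleftrightarrow>
        (\<forall>f \<in> carrier D - {\<zero>\<^bsub>D\<^esub>}.
          act_set C {f} = act_set C ((f <#\<^bsub>D\<^esub> carrier D) #>\<^bsub>D\<^esub> f))) \<and>
      (reduced_ring D \<longleftrightarrow>
        (\<forall>f \<in> carrier D - {\<zero>\<^bsub>D\<^esub>}. act_set C {f} = act_set C {f \<otimes>\<^bsub>D\<^esub> f})))"
proof -
  interpret C: coring A C by (rule assms(3))
  \<comment> \<open>In each of these four pairs the first fact gives the ring property from the
    condition on C, and the second the converse, which draws on flatness and on coretractability or
    the self-cogenerator property.\<close>
  note prime = C.dual_ring_primeI[OF assms(4)] C.prime_act_set[OF assms(5)]
  note dom = C.dual_ring_domainI[OF assms(4)] C.domain_act_set[OF assms(5)]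
  note semiprime = C.dual_ring_semiprimeI C.semiprime_act_set[OF assms(5)]
  note reduced = C.dual_ring_reducedI C.reduced_act_set[OF assms(5)]
  show ?thesis
    unfolding Let_def
  proof (intro conjI impI iffI, goal_cases)
    case 1 then show ?case by (intro prime(1)) blast
  next
    case 2 then show ?case by (intro dom(1)) blast
  next
    case 3 then show ?case using prime(2) by blast
  next
    case 4 then show ?case by (intro prime(1)) blast
  next
    case 5 then show ?case using dom(2) by blast
  next
    case 6 then show ?case by (intro dom(1)) blast
  next
    case 7 then show ?case by (intro semiprime(1)) blast
  next
    case 8 then show ?case by (intro reduced(1)) blast
  next
    case 9 then show ?case using semiprime(2) by blast
  next
    case 10 then show ?case by (intro semiprime(1)) blast
  next
    case 11 then show ?case using reduced(2) by blast
  next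
    case 12 then show ?case by (intro reduced(1)) blast
  qed
qed

end
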